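(* Let $B=(B_t)_{t\ge 0}$ be a standard one-dimensional Brownian motion with $B_0=0$. (1) There are absolute constants $0<c_1,c_2<\infty$ such that for every twice continuously differentiable function $f:[0,\infty)\to\mathbb{R}$ with $f(0)>0$ and every $T>0$, $$ \mathbb{P}\left[ B_t \leq f(t),\ 0\leq t\leq T\right] \;\geq\; \mathbb{P}\left[ B_t \leq f(0),\ 0\leq t\leq T\right]\cdot \exp\left(-\frac{1}{2}\int_0^T f'(s)^2 \,\mathrm{d}s - c_1 \int_0^T |f''(s)| \sqrt{s}\,\mathrm{d}s - c_2 \sqrt{T}\, |f'(T)|\right). $$ (2) In particular, let $f:[0,\infty)\to\mathbb{R}$ be twice continuously differentiable with $f(0)>0$. If $$ \int_1^\infty |f(t)|\, t^{-3/2}\,\mathrm{d}t<\infty $$ and $f'(t)\leq 0$ and $f''(t)\geq 0$ for all sufficiently large $t$, then $$ \mathbb{P}\left[ B_t \leq f(t),\ 0\leq t\leq T\right]\approx T^{-1/2},\qquad T\to\infty . $$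
   Context: $\mathbb{P}[B_t\le f(t),\ 0\le t\le T]$ denotes the probability that $B_t\le f(t)$ holds for all $t\in[0,T]$. "Absolute constants" means that $c_1,c_2$ depend neither on $f$ nor on $T$. For positive functions $a,b$, the notation $a(T)\approx b(T)$ as $T\to\infty$ means that there are constants $0<k_1\le k_2<\infty$ with $k_1 a(T)\leq b(T)\leq k_2 a(T)$ for all sufficiently large $T$ (in part (2) these constants may depend on $f$). *)

theory Defs
  imports "HOL-Probability.Probability"
begin

text \<open>
  All paths are required to be continuous (not just almost all of them), so that the events
  \<open>\<forall>t\<in>{0..T}. B t \<omega> \<le> f t\<close> with continuous \<open>f\<close> are measurable without
  completing \<open>M\<close>.  Only the times \<open>t \<ge> 0\<close> are constrained.
\<close>

locale standard_brownian_motion = prob_space M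
  for M :: "'a measure" and B :: "real \<Rightarrow> 'a \<Rightarrow> real" +
  assumes random_variable: "0 \<le> t \<Longrightarrow> B t \<in> borel_measurable M"
    and start_zero: "\<omega> \<in> space M \<Longrightarrow> B 0 \<omega> = 0"
    and indep_increments:
      "0 \<le> \<tau> 0 \<Longrightarrow> (\<And>i. i < n \<Longrightarrow> \<tau> i \<le> \<tau> (Suc i)) \<Longrightarrow>
        indep_vars (\<lambda>_. borel) (\<lambda>i \<omega>. B (\<tau> (Suc i)) \<omega> - B (\<tau> i) \<omega>) {..<n::nat}"
    and normal_increments:
      "0 \<le> s \<Longrightarrow> s < t \<Longrightarrow>
        distributed M lborel (\<lambda>\<omega>. B t \<omega> - B s \<omega>) (normal_density 0 (sqrt (t - s)))"
    and continuous_paths: "\<omega> \<in> space M \<Longrightarrow> continuous_on {0..} (\<lambda>t. B t \<omega>)"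

text \<open>
  \<open>f\<close> is twice continuously differentiable on \<open>[0,\<infinity>)\<close> (one-sided at \<open>0\<close>) with first and
  second derivatives \<open>f'\<close> and \<open>f''\<close>, which are thereby determined uniquely on \<open>[0,\<infinity>)\<close>.
\<close>

definition C2_halfline :: "(real \<Rightarrow> real) \<Rightarrow> (real \<Rightarrow> real) \<Rightarrow> (real \<Rightarrow> real) \<Rightarrow> bool" where
  "C2_halfline f f' f'' \<longleftrightarrow>
     (\<forall>t\<ge>0. (f has_real_derivative f' t) (at t within {0..})) \<and>
     (\<forall>t\<ge>0. (f' has_real_derivative f'' t) (at t within {0..})) \<and>
     continuous_on {0..} f''"

end

theory Submission
  imports Defs
begin

text \<open>
  Restrict the paths to the grid \<open>k T / n\<close>, \<open>k \<le> n\<close>, and let \<open>n \<rightarrow> \<infinity>\<close>; this avoids stochastic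
  integrals. The increments over a grid are independent Gaussians, so shifting them by the increments
  of \<open>f\<close> has an explicit density \<open>exp Z\<close> (a discrete Cameron--Martin formula), and Jensen's inequality
  for the law conditioned on \<open>A = {B \<le> f 0 on [0, T]}\<close> bounds the probability of staying below \<open>f\<close>
  from below by \<open>P(A) exp(E[Z | A])\<close>. After a summation by parts this requires only
  \<open>E[\<bar>B s\<bar> | A] \<le> 6 \<surd>s\<close>, uniformly in the level \<open>f 0\<close> and in \<open>T \<ge> s\<close>.

  For the moment bound let \<open>a = f 0\<close>, \<open>Y = a - B s\<close>, and let \<open>u y\<close> be the probability that the path restarted at
  \<open>s\<close> stays below \<open>y\<close> for the remaining time. By the Markov property, conditioning on \<open>A\<close>
  weights the event \<open>A\<^sub>s = {B \<le> a on [0, s]}\<close> by \<open>u Y\<close>. By the reflection principle \<open>u\<close> is increasing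
  and \<open>y / u y\<close> is increasing, so Chebyshev's association inequality allows replacing the weight \<open>u Y\<close> by \<open>1\<close>
  for the positive part of \<open>B s\<close> and by \<open>Y\<close> for the negative part; the resulting
  expectations are computed from the reflection principle.

  In the second part the hypotheses on \<open>f\<close> make the exponent bounded in \<open>T\<close>, by integration by parts.
\<close>

text \<open>The obstacle is uniformity: the moment bound must hold for every ratio of the level to
  \<open>sqrt s\<close> and for every remaining time \<open>T - s\<close>. The two comparison
  weights are the extreme cases. The weight \<open>1\<close> means that no time remains; the weight
  \<open>Y\<close> is harmonic for Brownian motion killed at the level and corresponds to staying
  below it forever, which turns \<open>Y\<close> into a three-dimensional Bessel process. The true
  weight \<open>u Y\<close> lies between the two in the order of monotone ratios, and each sign of
  \<open>B s\<close> is compared with the extreme that favours it. The positive part contributes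
  \<open>2 * sqrt s\<close> and the negative part \<open>4 * sqrt s\<close>; their sum is why both
  absolute constants are 6. The density lives on a grid, yet the conditioning event is the one in
  continuous time: it is contained in the grid event, and its moments are accessible by reflection.
  Shifting by exact increments of \<open>f\<close> reproduces the boundary at all grid points, so
  the only discretisation error in the exponent is of the order of the square root of the
  mesh.\<close>

section \<open>Continuous functions on grids\<close>

lemma grid_point_mem:
  fixes T :: real
  assumes "0 \<le> T" "k \<le> n"
  shows "real k * T / real n \<in> {0..T}"
proof -
  have "real k * T \<le> real n * T" using assms by (intro mult_right_mono) auto
  \<comment> \<open>For \<open>n = 0\<close> division by zero makes the grid point \<open>0\<close>,
    so statements quantified over all \<open>n\<close> need no exception.\<close>
  then show ?thesis using assms by (cases "n = 0") (auto simp: field_simps)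
qed

lemma grid_eventually_pos:
  fixes g :: "real \<Rightarrow> real"
  assumes g: "continuous_on {0..T} g" and t: "t \<in> {0..T}" and pos: "g t > 0"
  shows "\<forall>\<^sub>F n in sequentially. \<exists>k\<le>n. g (real k * T / real n) > 0"
proof (cases "T = 0")
  case True
  then show ?thesis using t pos by (auto intro!: always_eventually exI[of _ 0])
next
  case False
  then have T: "T > 0" using t by auto
  \<comment> \<open>Index of the last grid point that is not to the right of \<open>t\<close>; it is
    within \<open>T / n\<close> of \<open>t\<close>.\<close>
  define k where "k n = nat \<lfloor>t * real n / T\<rfloor>" for n :: nat
  define x where "x n = real (k n) * T / real n" for n
  have kle: "k n \<le> n" for n
  proof -
    have "t * real n / T \<le> real n" using T t mult_right_mono[of t T "real n"] by (simp add: divide_simps mult.commute)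
    then show ?thesis unfolding k_def by linarith
  qed
  have dist: "\<bar>x n - t\<bar> \<le> T / real n" if n: "n > 0" for n
  proof -
    have "0 \<le> t * real n / T" using T t by auto
    then have "real (k n) \<le> t * real n / T" "t * real n / T \<le> real (k n) + 1"
      unfolding k_def by linarith+
    then have "real (k n) * T \<le> t * real n" "t * real n \<le> (real (k n) + 1) * T"
      using T by (auto simp: field_simps)
    then have "x n \<le> t" "t \<le> x n + T / real n"
      using n unfolding x_def
      by (simp_all add: add_divide_distrib[symmetric] pos_divide_le_eq pos_le_divide_eq algebra_simps)
    then show ?thesis by simp
  qed
  have "(\<lambda>n. T / real n) \<longlonglongrightarrow> 0" by (rule lim_const_over_n)
  then have "(\<lambda>n. x n - t) \<longlonglongrightarrow> 0"
    by (rule Lim_null_comparison[rotated])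
       (auto intro!: eventually_mono[OF eventually_gt_at_top[of 0]] dist)
  then have "x \<longlonglongrightarrow> t" by (simp add: LIM_zero_iff)
  moreover have "x n \<in> {0..T}" for n
    unfolding x_def using grid_point_mem[OF _ kle] T by auto
  ultimately have "(\<lambda>n. g (x n)) \<longlonglongrightarrow> g t"
    using g t by (auto intro: continuous_on_tendsto_compose)
  then have "\<forall>\<^sub>F n in sequentially. g (x n) > 0" using pos by (rule order_tendstoD)
  then show ?thesis by eventually_elim (use kle in \<open>auto simp: x_def\<close>)
qed

text \<open>The grids are not nested, so the grid conditions are not monotone in \<open>n\<close>.
  The truth value is nevertheless eventually constant, and the real-valued form fits dominated
  convergence.\<close>

lemma grid_nonpos_LIMSEQ:
  fixes g :: "real \<Rightarrow> real"
  assumes g: "continuous_on {0..T} g" and T: "0 \<le> T"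
  shows "(\<lambda>n. of_bool (\<forall>k\<le>n. g (real k * T / real n) \<le> 0) :: real)
           \<longlonglongrightarrow> of_bool (\<forall>t\<in>{0..T}. g t \<le> 0)"
proof (cases "\<forall>t\<in>{0..T}. g t \<le> 0")
  case True
  then have "\<forall>k\<le>n. g (real k * T / real n) \<le> 0" for n
    using grid_point_mem[OF T, of _ n] by blast
  with True show ?thesis by simp
next
  case False
  then obtain t where "t \<in> {0..T}" "g t > 0" by (auto simp: not_le)
  from grid_eventually_pos[OF g this]
  have "\<forall>\<^sub>F n in sequentially. of_bool (\<forall>k\<le>n. g (real k * T / real n) \<le> 0) = (0::real)"
    by eventually_elim (auto simp: not_le)
  with False show ?thesis by (auto intro: tendsto_eventually)
qed

text \<open>By uniform continuity, the first grid value above the level \<open>a\<close> overshoots only slightly.\<close>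

lemma grid_first_passage:
  fixes b :: "real \<Rightarrow> real"
  assumes b: "continuous_on {0..T} b" and b0: "b 0 \<le> a" and t: "t \<in> {0..T}" "b t > a"
    and e: "e > 0"
  shows "\<forall>\<^sub>F n in sequentially. \<exists>k\<le>n. (\<forall>j<k. b (real j * T / real n) \<le> a) \<and>
            a < b (real k * T / real n) \<and> b (real k * T / real n) < a + e"
proof -
  have T: "T \<ge> 0" using t by auto
  have "uniformly_continuous_on {0..T} b"
    using b by (rule compact_uniformly_continuous) auto
  then obtain d where d: "d > 0" "\<And>x y. x \<in> {0..T} \<Longrightarrow> y \<in> {0..T} \<Longrightarrow> dist y x < d \<Longrightarrow> dist (b y) (b x) < e"
    using e unfolding uniformly_continuous_on_def by metis
  have "(\<lambda>n. T / real n) \<longlonglongrightarrow> 0" by (rule lim_const_over_n)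
  then have small: "\<forall>\<^sub>F n in sequentially. T / real n < d" using d(1) by (rule order_tendstoD)
  have hit: "\<forall>\<^sub>F n in sequentially. \<exists>k\<le>n. b (real k * T / real n) - a > 0"
    by (rule grid_eventually_pos[OF _ t(1)]) (use b t in \<open>auto intro: continuous_intros\<close>)
  show ?thesis using small hit eventually_gt_at_top[of 0]
  proof eventually_elim
    case (elim n)
    let ?P = "\<lambda>k. b (real k * T / real n) > a"
    define k where "k = (LEAST k. ?P k)"
    obtain k' where k': "k' \<le> n" "?P k'" using elim by auto
    have k: "?P k" unfolding k_def using k'(2) by (rule LeastI)
    have "k \<le> k'" unfolding k_def using k'(2) by (rule Least_le)
    have less: "\<forall>j<k. b (real j * T / real n) \<le> a"
      using not_less_Least[of _ ?P] by (auto simp: k_def not_less)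
    have "k \<noteq> 0" using k b0 by (intro notI) auto
    then obtain j where j: "k = Suc j" by (cases k) auto
    have kn: "k \<le> n" using \<open>k \<le> k'\<close> k' by simp
    have "dist (real k * T / real n) (real j * T / real n) < d"
      using elim T by (simp add: j dist_real_def divide_simps) (simp add: algebra_simps)
    then have "dist (b (real k * T / real n)) (b (real j * T / real n)) < e"
      using kn j by (intro d(2) grid_point_mem T) auto
    moreover have "b (real j * T / real n) \<le> a" using less j by auto
    ultimately show ?case using k less kn by (intro exI[of _ k]) (auto simp: dist_real_def)
  qed
qed

section \<open>Gaussian random variables\<close>

context prob_space begin

text \<open>A density gives no mass to a single point. This discards the ties that arise when strict
  inequalities are passed to the limit or reflected.\<close>

lemma distributed_AE_neq:
  fixes X :: "'a \<Rightarrow> real"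
  assumes X: "distributed M lborel X f"
  shows "AE \<omega> in M. X \<omega> \<noteq> x"
proof -
  have [measurable]: "random_variable borel X" using distributed_measurable[OF X] by simp
  have "AE y in lborel. y \<in> - {x}"
    using AE_lborel_singleton[of x] by simp
  then have "AE y in density lborel f. y \<in> - {x}"
    using distributed_borel_measurable[OF X] by (subst AE_density) auto
  then have "AE y in distr M lborel X. y \<noteq> x"
    unfolding distributed_distr_eq_density[OF X] by simp
  then show ?thesis by (subst (asm) AE_distr_iff) auto
qed

lemma distributed_normal_minus:
  assumes X: "distributed M lborel X (normal_density 0 \<sigma>)" and "\<sigma> > 0"
  shows "distributed M lborel (\<lambda>\<omega>. - X \<omega>) (normal_density 0 \<sigma>)"
  using normal_density_affine[OF X \<open>\<sigma> > 0\<close>, of "-1" 0] by simp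

lemma distributed_imp_distr_eq:
  fixes X Y :: "'a \<Rightarrow> real"
  assumes "distributed M lborel X f" "distributed M lborel Y f"
  shows "distr M borel X = distr M borel Y"
proof -
  have "distr M borel Z = distr M lborel Z" for Z :: "'a \<Rightarrow> real"
    by (rule distr_cong) auto
  then show ?thesis using assms[THEN distributed_distr_eq_density] by simp
qed

lemma integral_distr_cong:
  fixes h :: "'b \<Rightarrow> real"
  assumes "distr M N X = distr M N Y" "random_variable N X" "random_variable N Y"
    "h \<in> borel_measurable N"
  shows "expectation (\<lambda>\<omega>. h (X \<omega>)) = expectation (\<lambda>\<omega>. h (Y \<omega>))"
  using assms by (metis integral_distr)

lemma expectation_normal_symmetric:
  assumes X: "distributed M lborel X (normal_density 0 \<sigma>)" and "\<sigma> > 0"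
    and [measurable]: "(h :: real \<Rightarrow> real) \<in> borel_measurable borel"
  shows "expectation (\<lambda>\<omega>. h (- X \<omega>)) = expectation (\<lambda>\<omega>. h (X \<omega>))"
proof (rule integral_distr_cong[where N = borel and X = "\<lambda>\<omega>. - X \<omega>"])
  show "distr M borel (\<lambda>\<omega>. - X \<omega>) = distr M borel X"
    by (rule distributed_imp_distr_eq[OF distributed_normal_minus[OF X \<open>\<sigma> > 0\<close>] X])
  show "random_variable borel X" using distributed_measurable[OF X] by simp
  then show "random_variable borel (\<lambda>\<omega>. - X \<omega>)" by simp
qed fact

lemma normal_moments:
  assumes X: "distributed M lborel X (normal_density 0 \<sigma>)" and s: "\<sigma> > 0"
  shows "integrable M X" "integrable M (\<lambda>\<omega>. (X \<omega>)\<^sup>2)" "expectation X = 0"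
    "expectation (\<lambda>\<omega>. (X \<omega>)\<^sup>2) = \<sigma>\<^sup>2" "expectation (\<lambda>\<omega>. \<bar>X \<omega>\<bar>) \<le> \<sigma>"
proof -
  show i1: "integrable M X"
    using integrable_normal_moment_nz_1[OF s, of 0]
    by (subst distributed_integrable[OF X, of "\<lambda>x. x", symmetric]) auto
  show i2: "integrable M (\<lambda>\<omega>. (X \<omega>)\<^sup>2)"
    using integrable_normal_moment[OF s, of 0 2]
    by (subst distributed_integrable[OF X, of "\<lambda>x. x\<^sup>2", symmetric]) auto
  show e: "expectation X = 0" by (rule normal_distributed_expectation[OF s X])
  show v: "expectation (\<lambda>\<omega>. (X \<omega>)\<^sup>2) = \<sigma>\<^sup>2"
    using normal_distributed_variance[OF s X] e by simp
  \<comment> \<open>The inequality of arithmetic and geometric means reduces the first absolute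
    moment to the variance. The exact value \<open>\<sigma> * sqrt (2 / pi)\<close> is smaller, but
    \<open>\<sigma>\<close> suffices.\<close>
  have "\<bar>x\<bar> \<le> (x\<^sup>2 / \<sigma> + \<sigma>) / 2" for x :: real
  proof -
    have "0 \<le> (\<bar>x\<bar> - \<sigma>)\<^sup>2" by simp
    then have "2 * \<bar>x\<bar> * \<sigma> \<le> x\<^sup>2 + \<sigma>\<^sup>2" by (simp add: power2_diff)
    then show ?thesis using s by (simp add: field_simps power2_eq_square)
  qed
  then have "expectation (\<lambda>\<omega>. \<bar>X \<omega>\<bar>) \<le> expectation (\<lambda>\<omega>. ((X \<omega>)\<^sup>2 / \<sigma> + \<sigma>) / 2)"
    using i1 i2 by (intro integral_mono) auto
  also have "\<dots> = \<sigma>" using i2 s v by (simp add: prob_space power2_eq_square)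
  finally show "expectation (\<lambda>\<omega>. \<bar>X \<omega>\<bar>) \<le> \<sigma>" .
qed

end

section \<open>Brownian paths below a continuous boundary, seen on grids\<close>

context standard_brownian_motion begin

lemma continuous_path: "\<omega> \<in> space M \<Longrightarrow> continuous_on {0..T} (\<lambda>t. B t \<omega>)"
  by (rule continuous_on_subset[OF continuous_paths]) auto

lemma distributed_B:
  assumes "0 < t"
  shows "distributed M lborel (B t) (normal_density 0 (sqrt t))"
proof -
  have "distr M lborel (\<lambda>\<omega>. B t \<omega> - B 0 \<omega>) = distr M lborel (B t)"
    by (rule distr_cong) (auto simp: start_zero)
  with normal_increments[of 0 t] random_variable[of t] assms show ?thesis
    unfolding distributed_def by auto
qed

text \<open>By path continuity the uncountably many conditions reduce to countably many, which makes
  the event measurable.\<close>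

lemma below_grid_iff:
  assumes f: "continuous_on {0..T} f" and T: "0 \<le> T" and \<omega>: "\<omega> \<in> space M"
  shows "(\<forall>t\<in>{0..T}. B t \<omega> \<le> f t) \<longleftrightarrow>
    (\<forall>n. \<forall>k\<le>n. B (real k * T / real n) \<omega> \<le> f (real k * T / real n))" (is "?L \<longleftrightarrow> ?R")
proof
  assume ?L then show ?R using grid_point_mem[OF T] by blast
next
  assume R: ?R
  show ?L
  proof (rule ccontr)
    assume "\<not> ?L"
    then obtain t where t: "t \<in> {0..T}" "B t \<omega> - f t > 0" by (auto simp: not_le)
    have c: "continuous_on {0..T} (\<lambda>t. B t \<omega> - f t)"
      by (intro continuous_intros continuous_path f \<omega>)
    from eventually_happens[OF grid_eventually_pos[OF c t]] R show False
      by (auto simp: not_less[symmetric])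
  qed
qed

lemma below_measurable:
  assumes f: "continuous_on {0..T} f" and T: "0 \<le> T"
  shows "{\<omega> \<in> space M. \<forall>t\<in>{0..T}. B t \<omega> \<le> f t} \<in> events"
proof -
  have [measurable]: "B (real k * T / real n) \<in> borel_measurable M" for k n
    using T by (intro random_variable) auto
  have "{\<omega> \<in> space M. \<forall>t\<in>{0..T}. B t \<omega> \<le> f t} =
    {\<omega> \<in> space M. \<forall>n. \<forall>k\<in>{..n}. B (real k * T / real n) \<omega> \<le> f (real k * T / real n)}"
    using below_grid_iff[OF f T] by auto
  also have "\<dots> \<in> events" by measurable
  finally show ?thesis .
qed

lemma below_LIMSEQ:
  assumes f: "continuous_on {0..T} f" and T: "0 \<le> T" and \<omega>: "\<omega> \<in> space M"
  shows "(\<lambda>n. of_bool (\<forall>k\<le>n. B (real k * T / real n) \<omega> \<le> f (real k * T / real n)) :: real)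
           \<longlonglongrightarrow> of_bool (\<forall>t\<in>{0..T}. B t \<omega> \<le> f t)"
proof -
  have "continuous_on {0..T} (\<lambda>t. B t \<omega> - f t)"
    by (intro continuous_intros continuous_path f \<omega>)
  from grid_nonpos_LIMSEQ[OF this T] show ?thesis by simp
qed

text \<open>Allows every result about \<open>B\<close> to be applied to the path after
  \<open>s\<close> by interpretation. Independence from the past is a separate matter, settled in
  \<open>markov_grid\<close>.\<close>

lemma restart:
  assumes s: "0 \<le> s"
  shows "standard_brownian_motion M (\<lambda>r \<omega>. B (s + r) \<omega> - B s \<omega>)"
proof unfold_locales
  fix t :: real assume "0 \<le> t"
  then show "(\<lambda>\<omega>. B (s + t) \<omega> - B s \<omega>) \<in> borel_measurable M"
    using s by (intro borel_measurable_diff random_variable) auto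
next
  fix \<omega> show "B (s + 0) \<omega> - B s \<omega> = 0" by simp
next
  fix \<tau> :: "nat \<Rightarrow> real" and n :: nat
  assume "0 \<le> \<tau> 0" "\<And>i. i < n \<Longrightarrow> \<tau> i \<le> \<tau> (Suc i)"
  then have "indep_vars (\<lambda>_. borel)
      (\<lambda>i \<omega>. B (s + \<tau> (Suc i)) \<omega> - B (s + \<tau> i) \<omega>) {..<n}"
    using s by (intro indep_increments) auto
  then show "indep_vars (\<lambda>_. borel)
      (\<lambda>i \<omega>. B (s + \<tau> (Suc i)) \<omega> - B s \<omega> - (B (s + \<tau> i) \<omega> - B s \<omega>)) {..<n}"
    by simp
next
  fix r t :: real assume "0 \<le> r" "r < t"
  then show "distributed M lborel (\<lambda>\<omega>. B (s + t) \<omega> - B s \<omega> - (B (s + r) \<omega> - B s \<omega>))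
      (\<lambda>x. ennreal (normal_density 0 (sqrt (t - r)) x))"
    using normal_increments[of "s + r" "s + t"] s by simp
next
  fix \<omega> assume "\<omega> \<in> space M"
  then show "continuous_on {0..} (\<lambda>t. B (s + t) \<omega> - B s \<omega>)"
    using s by (intro continuous_intros continuous_on_compose2[OF continuous_paths]) auto
qed

end

subsection \<open>Reflection principle\<close>

context prob_space begin

text \<open>Dominated convergence for indicators. Eventual agreement outside a null set is the right
  hypothesis here, since the approximating events are not monotone and may fail to converge at
  ties.\<close>

lemma prob_LIMSEQ_eventually:
  assumes ev: "\<And>n. A n \<in> events" "A' \<in> events"
    and lim: "AE \<omega> in M. \<forall>\<^sub>F n in sequentially. \<omega> \<in> A n \<longleftrightarrow> \<omega> \<in> A'"
  shows "(\<lambda>n. prob (A n)) \<longlonglongrightarrow> prob A'"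
proof -
  have "(\<lambda>n. expectation (indicat_real (A n))) \<longlonglongrightarrow> expectation (indicat_real A')"
  proof (rule integral_dominated_convergence[where w = "\<lambda>_. 1"])
    show "AE \<omega> in M. (\<lambda>n. indicat_real (A n) \<omega>) \<longlonglongrightarrow> indicat_real A' \<omega>"
      using lim
    proof eventually_elim
      case (elim \<omega>)
      then have "\<forall>\<^sub>F n in sequentially. indicat_real (A n) \<omega> = indicat_real A' \<omega>"
        by eventually_elim (simp add: indicator_def)
      then show ?case by (rule tendsto_eventually)
    qed
  qed (use ev in \<open>auto simp: indicator_def\<close>)
  then show ?thesis using ev by simp
qed

text \<open>By independence the joint law is the product of the marginals, so it is unchanged if
  each marginal is. With symmetric increments and signs fixed in advance this is the mechanism of
  reflection.\<close>

lemma indep_vars_signs_distr: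
  assumes ind: "indep_vars (\<lambda>_. borel) X I" and I: "I \<noteq> {}"
    and sym: "\<And>i. i \<in> I \<Longrightarrow> distr M borel (\<lambda>\<omega>. e i * X i \<omega>) = distr M borel (X i)"
  shows "distr M (\<Pi>\<^sub>M i\<in>I. borel) (\<lambda>\<omega>. \<lambda>i\<in>I. e i * X i \<omega> :: real) =
    distr M (\<Pi>\<^sub>M i\<in>I. borel) (\<lambda>\<omega>. \<lambda>i\<in>I. X i \<omega>)"
proof -
  have X: "i \<in> I \<Longrightarrow> random_variable borel (X i)" for i
    using ind by (simp add: indep_vars_def)
  have "indep_vars (\<lambda>_. borel) (\<lambda>i \<omega>. e i * X i \<omega>) I"
    by (rule indep_vars_compose2[OF ind]) simp
  then have "distr M (\<Pi>\<^sub>M i\<in>I. borel) (\<lambda>\<omega>. \<lambda>i\<in>I. e i * X i \<omega>) =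
      (\<Pi>\<^sub>M i\<in>I. distr M borel (\<lambda>\<omega>. e i * X i \<omega>))"
    using I X by (subst (asm) indep_vars_iff_distr_eq_PiM') auto
  also have "\<dots> = (\<Pi>\<^sub>M i\<in>I. distr M borel (X i))"
    by (intro PiM_cong refl sym)
  also have "\<dots> = distr M (\<Pi>\<^sub>M i\<in>I. borel) (\<lambda>\<omega>. \<lambda>i\<in>I. X i \<omega>)"
    using ind I X by (subst (asm) indep_vars_iff_distr_eq_PiM') auto
  finally show ?thesis .
qed

end

context standard_brownian_motion begin

lemma grid_increments:
  assumes T: "0 < T" and n: "0 < n"
  defines "X \<equiv> \<lambda>i \<omega>. B (real (Suc i) * T / real n) \<omega> - B (real i * T / real n) \<omega>"
  shows "indep_vars (\<lambda>_. borel) X {..<n}"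
    and "distributed M lborel (X i) (normal_density 0 (sqrt (T / real n)))"
    and "\<omega> \<in> space M \<Longrightarrow> (\<Sum>i<k. X i \<omega>) = B (real k * T / real n) \<omega>"
proof -
  have "real (Suc i) * T / real n - real i * T / real n = T / real n" for i
    using n by (simp add: field_simps)
  then show "distributed M lborel (X i) (normal_density 0 (sqrt (T / real n)))"
    using normal_increments[of "real i * T / real n" "real (Suc i) * T / real n"] T n
    by (simp add: X_def divide_simps)
  show "indep_vars (\<lambda>_. borel) X {..<n}"
    unfolding X_def using T n
    by (intro indep_increments[where \<tau> = "\<lambda>i. real i * T / real n"])
       (auto simp: divide_simps mult_right_mono)
  assume "\<omega> \<in> space M"
  then show "(\<Sum>i<k. X i \<omega>) = B (real k * T / real n) \<omega>"
    unfolding X_def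
    by (subst sum_lessThan_telescope[where f = "\<lambda>k. B (real k * T / real n) \<omega>"]) (simp add: start_zero)
qed

text \<open>For a fixed index \<open>k\<close>, first passage at \<open>k\<close> depends only on
  the increments before \<open>k\<close>. Flipping the signs of all later increments preserves the
  joint law and the passage event, and moves the endpoint to its mirror image in \<open>b k\<close>.
  Fixing \<open>k\<close> takes the place of the strong Markov property.\<close>

lemma reflect_grid:
  assumes T: "0 < T" and n: "0 < n" and k: "k \<le> n"
  defines "b \<equiv> \<lambda>k. B (real k * T / real n)"
  shows "prob {\<omega> \<in> space M. (\<forall>j<k. b j \<omega> \<le> a) \<and> a < b k \<omega> \<and> x < B T \<omega>} =
    prob {\<omega> \<in> space M. (\<forall>j<k. b j \<omega> \<le> a) \<and> a < b k \<omega> \<and> x < 2 * b k \<omega> - B T \<omega>}"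
proof -
  define X where "X i \<omega> = B (real (Suc i) * T / real n) \<omega> - B (real i * T / real n) \<omega>" for i \<omega>
  note inc = grid_increments[OF T n, folded X_def]
  have X [measurable]: "random_variable borel (X i)" for i
    using distributed_measurable[OF inc(2)] by simp
  define N where "N = (\<Pi>\<^sub>M i\<in>{..<n}. (borel :: real measure))"
  define e :: "nat \<Rightarrow> real" where "e = (\<lambda>i. if i < k then 1 else - 1)"
  define V where "V = (\<lambda>\<omega>. \<lambda>i\<in>{..<n}. X i \<omega>)"
  define W where "W = (\<lambda>\<omega>. \<lambda>i\<in>{..<n}. e i * X i \<omega>)"
  define S where "S = {v \<in> space N. (\<forall>j\<in>{..<k}. (\<Sum>i<j. v i) \<le> a) \<and> a < (\<Sum>i<k. v i) \<and> x < (\<Sum>i<n. v i)}"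
  have "(\<lambda>v. \<Sum>i<j. v i) \<in> borel_measurable N" if "j \<le> n" for j
    unfolding N_def using that by (intro borel_measurable_sum measurable_component_singleton) auto
  note this [measurable]
  have [measurable]: "Measurable.pred N (\<lambda>v. \<forall>j\<in>{..<k}. (\<Sum>i<j. v i) \<le> a)"
    by (rule pred_intros_finite) (use k in \<open>auto\<close>)
  have S: "S \<in> sets N" unfolding S_def using k by measurable
  have V: "V \<in> measurable M N" and W: "W \<in> measurable M N"
    unfolding V_def W_def N_def by (intro measurable_restrict; simp)+
  have "distr M N W = distr M N V"
    unfolding N_def V_def W_def
  proof (rule indep_vars_signs_distr[OF inc(1)])
    fix i
    have "distr M borel (\<lambda>\<omega>. - X i \<omega>) = distr M borel (X i)"
      using T n by (intro distributed_imp_distr_eq[OF distributed_normal_minus[OF inc(2)] inc(2)]) auto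
    then show "distr M borel (\<lambda>\<omega>. e i * X i \<omega>) = distr M borel (X i)"
      by (simp add: e_def)
  qed (use n in auto)
  then have "measure (distr M N V) S = measure (distr M N W) S" by simp
  then have eq: "prob (V -` S \<inter> space M) = prob (W -` S \<inter> space M)"
    using V W S by (simp add: measure_distr)
  have sumV: "(\<Sum>i<j. V \<omega> i) = b j \<omega>" if "j \<le> n" "\<omega> \<in> space M" for j \<omega>
  proof -
    have "(\<Sum>i<j. V \<omega> i) = (\<Sum>i<j. X i \<omega>)" using that by (intro sum.cong) (auto simp: V_def)
    then show ?thesis using inc(3) that by (simp add: b_def)
  qed
  have sumW: "(\<Sum>i<j. W \<omega> i) = b j \<omega>" if "j \<le> k" "\<omega> \<in> space M" for j \<omega>
  proof -
    have "(\<Sum>i<j. W \<omega> i) = (\<Sum>i<j. X i \<omega>)" using that k by (intro sum.cong) (auto simp: W_def e_def)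
    then show ?thesis using inc(3) that by (simp add: b_def)
  qed
  have bn: "b n = B T" using n by (simp add: b_def)
  have sumWn: "(\<Sum>i<n. W \<omega> i) = 2 * b k \<omega> - B T \<omega>" if \<omega>: "\<omega> \<in> space M" for \<omega>
  proof -
    have split: "(\<Sum>i<n. g i) = (\<Sum>i<k. g i) + (\<Sum>i\<in>{k..<n}. g i)" for g :: "nat \<Rightarrow> real"
      using k by (metis atLeast0LessThan sum.atLeastLessThan_concat zero_le)
    have "(\<Sum>i\<in>{k..<n}. W \<omega> i) = (\<Sum>i\<in>{k..<n}. - V \<omega> i)"
      by (intro sum.cong) (auto simp: W_def V_def e_def)
    also have "\<dots> = b k \<omega> - b n \<omega>"
      using split[of "V \<omega>"] sumV[OF k \<omega>] sumV[of n \<omega>] \<omega> by (simp add: sum_negf)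
    finally show ?thesis using split[of "W \<omega>"] sumW[of k \<omega>] \<omega> bn by simp
  qed
  have "V -` S \<inter> space M = {\<omega> \<in> space M. (\<forall>j<k. b j \<omega> \<le> a) \<and> a < b k \<omega> \<and> x < B T \<omega>}"
    using measurable_space[OF V] sumV k bn by (auto simp: S_def)
  moreover have "W -` S \<inter> space M = {\<omega> \<in> space M. (\<forall>j<k. b j \<omega> \<le> a) \<and> a < b k \<omega> \<and> x < 2 * b k \<omega> - B T \<omega>}"
    using measurable_space[OF W] sumW sumWn by (auto simp: S_def)
  ultimately show ?thesis using eq by simp
qed

text \<open>First passage at different grid indices is disjoint, so \<open>reflect_grid\<close> can
  be summed over \<open>k\<close>. As the mesh shrinks the overshoot over \<open>a\<close> vanishes
  and the mirror \<open>b k\<close> becomes \<open>a\<close>.\<close>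

lemma reflection_prob:
  assumes T: "0 < T" and a: "0 \<le> a"
  shows "prob {\<omega> \<in> space M. (\<exists>t\<in>{0..T}. a < B t \<omega>) \<and> x < B T \<omega>} =
    prob {\<omega> \<in> space M. (\<exists>t\<in>{0..T}. a < B t \<omega>) \<and> x < 2 * a - B T \<omega>}"
proof -
  define F where "F n k \<omega> \<longleftrightarrow> (\<forall>j<k. B (real j * T / real n) \<omega> \<le> a) \<and> a < B (real k * T / real n) \<omega>"
    for n k \<omega>
  have [measurable]: "random_variable borel (B (real k * T / real n))" for k n
    using T by (intro random_variable) auto
  have BT [measurable]: "random_variable borel (B T)"
    using T by (intro random_variable) auto
  have [measurable]: "Measurable.pred M (F n k)" for n k
  proof -
    have "F n k = (\<lambda>\<omega>. (\<forall>j\<in>{..<k}. B (real j * T / real n) \<omega> \<le> a) \<and> a < B (real k * T / real n) \<omega>)"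
      by (auto simp: F_def fun_eq_iff)
    then show ?thesis by simp
  qed
  have uniq: "k = k'" if "F n k \<omega>" "F n k' \<omega>" for n k k' \<omega>
    using that unfolding F_def by (meson linorder_neqE_nat not_le)
  define U where "U n = (\<Union>k\<in>{..n}. {\<omega> \<in> space M. F n k \<omega> \<and> x < B T \<omega>})" for n
  define V where "V n = (\<Union>k\<in>{..n}. {\<omega> \<in> space M. F n k \<omega> \<and> x < 2 * B (real k * T / real n) \<omega> - B T \<omega>})" for n
  have ev: "U n \<in> events" "V n \<in> events" for n by (auto simp: U_def V_def)
  have UV: "prob (U n) = prob (V n)" if n: "n > 0" for n
  proof -
    have "prob (U n) = (\<Sum>k\<le>n. prob {\<omega> \<in> space M. F n k \<omega> \<and> x < B T \<omega>})"
      unfolding U_def by (rule finite_measure_finite_Union) (auto simp: disjoint_family_on_def dest: uniq)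
    also have "\<dots> = (\<Sum>k\<le>n. prob {\<omega> \<in> space M. F n k \<omega> \<and> x < 2 * B (real k * T / real n) \<omega> - B T \<omega>})"
      using reflect_grid[OF T n] by (intro sum.cong) (auto simp: F_def)
    also have "\<dots> = prob (V n)"
      unfolding V_def by (rule finite_measure_finite_Union[symmetric]) (auto simp: disjoint_family_on_def dest: uniq)
    finally show ?thesis .
  qed
  have hit: "\<exists>t\<in>{0..T}. a < B t \<omega>" if "F n k \<omega>" "k \<le> n" for n k \<omega>
    using that grid_point_mem[of T k n] T by (auto simp: F_def)
  have passage: "\<forall>\<^sub>F n in sequentially. \<exists>k\<le>n. F n k \<omega> \<and> B (real k * T / real n) \<omega> < a + e"
    if "\<exists>t\<in>{0..T}. a < B t \<omega>" "\<omega> \<in> space M" "e > 0" for \<omega> e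
    using that grid_first_passage[OF continuous_path[OF that(2)], of a] a start_zero[OF that(2)]
    unfolding F_def by (auto simp: conj_assoc)
  define K where "K = {\<omega> \<in> space M. \<exists>t\<in>{0..T}. a < B t \<omega>}"
  have "K = space M - {\<omega> \<in> space M. \<forall>t\<in>{0..T}. B t \<omega> \<le> a}" by (auto simp: K_def not_le)
  then have K [measurable]: "K \<in> events" using below_measurable[of T "\<lambda>_. a"] T by auto
  let ?U = "{\<omega> \<in> space M. \<omega> \<in> K \<and> x < B T \<omega>}" and ?V = "{\<omega> \<in> space M. \<omega> \<in> K \<and> x < 2 * a - B T \<omega>}"
  have limU: "(\<lambda>n. prob (U n)) \<longlonglongrightarrow> prob ?U"
  proof (rule prob_LIMSEQ_eventually[OF ev(1)])
    show "AE \<omega> in M. \<forall>\<^sub>F n in sequentially. \<omega> \<in> U n \<longleftrightarrow> \<omega> \<in> ?U"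
    proof (intro AE_I2)
      fix \<omega> assume \<omega>: "\<omega> \<in> space M"
      show "\<forall>\<^sub>F n in sequentially. \<omega> \<in> U n \<longleftrightarrow> \<omega> \<in> ?U"
      proof (cases "\<omega> \<in> K")
        case True
        then have "\<exists>t\<in>{0..T}. a < B t \<omega>" by (auto simp: K_def)
        from passage[OF this \<omega>, of 1] show ?thesis
          by (auto elim!: eventually_mono simp: U_def K_def dest: hit)
      next
        case False
        then have "\<omega> \<notin> U n" for n using hit[of n _ \<omega>] by (auto simp: U_def K_def)
        then show ?thesis using False by simp
      qed
    qed
  qed simp
  have limV: "(\<lambda>n. prob (V n)) \<longlonglongrightarrow> prob ?V"
  proof (rule prob_LIMSEQ_eventually[OF ev(2)])
    show "AE \<omega> in M. \<forall>\<^sub>F n in sequentially. \<omega> \<in> V n \<longleftrightarrow> \<omega> \<in> ?V"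
      \<comment> \<open>The mirrored endpoint approaches \<open>2 * a - B T\<close> strictly from
        above. If that limit equals \<open>x\<close>, the strict inequality holds on every grid with
        a passage but fails in the limit, so this null event is removed.\<close>
      using distributed_AE_neq[OF distributed_B[OF T], of "2 * a - x"] AE_space
    proof eventually_elim
      case (elim \<omega>)
      note \<omega> = elim(2)
      show ?case
      proof (cases "\<omega> \<in> K")
        case False
        then have "\<omega> \<notin> V n" for n using hit[of n _ \<omega>] by (auto simp: V_def K_def)
        then show ?thesis using False by simp
      next
        case True
        then have ex: "\<exists>t\<in>{0..T}. a < B t \<omega>" by (auto simp: K_def)
        show ?thesis
        proof (cases "x < 2 * a - B T \<omega>")
          case less: True
          have "x < 2 * B (real k * T / real n) \<omega> - B T \<omega>" if "F n k \<omega>" for n k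
            using that less by (auto simp: F_def)
          then show ?thesis using passage[OF ex \<omega>, of 1] less True \<omega>
            by (auto elim!: eventually_mono simp: V_def)
        next
          case False
          \<comment> \<open>Half the gap: an overshoot below \<open>e\<close> keeps the mirrored
            endpoint below \<open>2 * (a + e) - B T\<close>, which is exactly
            \<open>x\<close>.\<close>
          define e where "e = (x - 2 * a + B T \<omega>) / 2"
          have "e > 0" using False elim(1) by (simp add: e_def)
          from passage[OF ex \<omega> this] show ?thesis
          proof eventually_elim
            case (elim n)
            then obtain k where k: "F n k \<omega>" "B (real k * T / real n) \<omega> < a + e" by auto
            then have "\<not> x < 2 * B (real k * T / real n) \<omega> - B T \<omega>"
              by (simp add: e_def field_simps)
            then have "\<omega> \<notin> V n" using uniq[OF k(1)] by (auto simp: V_def)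
            then show ?case using False by auto
          qed
        qed
      qed
    qed
  qed simp
  have "\<forall>\<^sub>F n in sequentially. prob (V n) = prob (U n)"
    using eventually_gt_at_top[of 0] by eventually_elim (rule UV[symmetric])
  from LIMSEQ_unique[OF limU Lim_transform_eventually[OF limV this]]
  have "prob ?U = prob ?V" .
  moreover have "?U = {\<omega> \<in> space M. (\<exists>t\<in>{0..T}. a < B t \<omega>) \<and> x < B T \<omega>}"
    "?V = {\<omega> \<in> space M. (\<exists>t\<in>{0..T}. a < B t \<omega>) \<and> x < 2 * a - B T \<omega>}"
    by (auto simp: K_def)
  ultimately show ?thesis by simp
qed

text \<open>\<open>reflection_prob\<close> says that, under the finite measure restricted to
  \<open>K\<close>, \<open>B T\<close> and its mirror image have the same tails, hence the same law.
  Equality of laws transfers to every measurable integrand.\<close>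

lemma reflection_expectation:
  fixes h :: "real \<Rightarrow> real"
  assumes T: "0 < T" and a: "0 \<le> a" and h [measurable]: "h \<in> borel_measurable borel"
  defines "K \<equiv> {\<omega> \<in> space M. \<exists>t\<in>{0..T}. a < B t \<omega>}"
  shows "expectation (\<lambda>\<omega>. indicator K \<omega> * h (B T \<omega>)) =
    expectation (\<lambda>\<omega>. indicator K \<omega> * h (2 * a - B T \<omega>))"
proof -
  have "K = space M - {\<omega> \<in> space M. \<forall>t\<in>{0..T}. B t \<omega> \<le> a}" by (auto simp: K_def not_le)
  then have K [measurable]: "K \<in> events" using below_measurable[of T "\<lambda>_. a"] T by auto
  have [measurable]: "random_variable borel (B T)" using T by (intro random_variable) auto
  define N where "N = density M (indicator K)"
  have sets_N [measurable_cong]: "sets N = events" by (simp add: N_def)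
  have em: "emeasure (distr N borel Y) {x<..} = prob {\<omega> \<in> space M. \<omega> \<in> K \<and> x < Y \<omega>}"
    if [measurable]: "random_variable borel Y" for Y and x :: real
  proof -
    have "emeasure (distr N borel Y) {x<..} = emeasure N {\<omega> \<in> space M. x < Y \<omega>}"
      by (subst emeasure_distr) (auto simp: N_def vimage_def intro!: arg_cong2[where f = emeasure])
    also have "\<dots> = (\<integral>\<^sup>+\<omega>. indicator K \<omega> * indicator {\<omega> \<in> space M. x < Y \<omega>} \<omega> \<partial>M)"
      unfolding N_def by (rule emeasure_density) auto
    also have "\<dots> = (\<integral>\<^sup>+\<omega>. indicator {\<omega> \<in> space M. \<omega> \<in> K \<and> x < Y \<omega>} \<omega> \<partial>M)"
      by (intro nn_integral_cong) (auto simp: indicator_def)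
    also have "\<dots> = emeasure M {\<omega> \<in> space M. \<omega> \<in> K \<and> x < Y \<omega>}" by simp
    finally show ?thesis by (simp add: emeasure_eq_measure)
  qed
  have "distr N borel (B T) = distr N borel (\<lambda>\<omega>. 2 * a - B T \<omega>)"
  proof (rule measure_eqI_lessThan)
    fix x
    show "emeasure (distr N borel (B T)) {x<..} < \<infinity>" by (simp add: em)
    have "{\<omega> \<in> space M. \<omega> \<in> K \<and> P \<omega>} = {\<omega> \<in> space M. (\<exists>t\<in>{0..T}. a < B t \<omega>) \<and> P \<omega>}" for P
      by (auto simp: K_def)
    then have "prob {\<omega> \<in> space M. \<omega> \<in> K \<and> x < B T \<omega>} =
        prob {\<omega> \<in> space M. \<omega> \<in> K \<and> x < 2 * a - B T \<omega>}"
      using reflection_prob[OF T a, of x] by (simp only:)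
    then show "emeasure (distr N borel (B T)) {x<..} = emeasure (distr N borel (\<lambda>\<omega>. 2 * a - B T \<omega>)) {x<..}"
      by (simp add: em)
  qed auto
  then have "integral\<^sup>L (distr N borel (B T)) h = integral\<^sup>L (distr N borel (\<lambda>\<omega>. 2 * a - B T \<omega>)) h"
    by simp
  then have "(\<integral>\<omega>. h (B T \<omega>) \<partial>N) = (\<integral>\<omega>. h (2 * a - B T \<omega>) \<partial>N)"
    by (simp add: integral_distr)
  moreover have "N = density M (\<lambda>\<omega>. ennreal (indicator K \<omega>))"
    by (simp add: N_def ennreal_indicator)
  ultimately show ?thesis by (simp add: integral_density)
qed

text \<open>Subtract from the paths ending at or below \<open>a\<close> those that crossed the
  level, then reflect the latter: they end above \<open>a\<close>, where crossing is automatic. The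
  path condition disappears, and only one-dimensional Gaussian expectations remain.\<close>

lemma expectation_below:
  fixes h :: "real \<Rightarrow> real"
  assumes T: "0 < T" and a: "0 \<le> a" and h [measurable]: "h \<in> borel_measurable borel"
    and int: "integrable M (\<lambda>\<omega>. h (B T \<omega>))" "integrable M (\<lambda>\<omega>. h (2 * a - B T \<omega>))"
  defines "A \<equiv> {\<omega> \<in> space M. \<forall>t\<in>{0..T}. B t \<omega> \<le> a}"
  shows "expectation (\<lambda>\<omega>. indicator A \<omega> * h (B T \<omega>)) =
    expectation (\<lambda>\<omega>. indicator {..a} (B T \<omega>) * h (B T \<omega>))
    - expectation (\<lambda>\<omega>. indicator {a<..} (B T \<omega>) * h (2 * a - B T \<omega>))"
proof -
  define K where "K = {\<omega> \<in> space M. \<exists>t\<in>{0..T}. a < B t \<omega>}"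
  have A [measurable]: "A \<in> events" using below_measurable[of T "\<lambda>_. a"] T by (auto simp: A_def)
  have "K = space M - A" by (auto simp: K_def A_def not_le)
  then have K [measurable]: "K \<in> events" by auto
  have [measurable]: "random_variable borel (B T)" using T by (intro random_variable) auto
  have T': "T \<in> {0..T}" using T by simp
  have "expectation (\<lambda>\<omega>. indicator A \<omega> * h (B T \<omega>)) =
    expectation (\<lambda>\<omega>. indicator {..a} (B T \<omega>) * h (B T \<omega>) - indicator K \<omega> * (indicator {..a} (B T \<omega>) * h (B T \<omega>)))"
    using T' by (intro Bochner_Integration.integral_cong) (auto simp: A_def K_def indicator_def not_le)
  also have "\<dots> = expectation (\<lambda>\<omega>. indicator {..a} (B T \<omega>) * h (B T \<omega>))
      - expectation (\<lambda>\<omega>. indicator K \<omega> * (indicator {..a} (B T \<omega>) * h (B T \<omega>)))"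
    by (intro Bochner_Integration.integral_diff Bochner_Integration.integrable_bound[OF int(1)])
       (auto simp: indicator_def)
  also have "expectation (\<lambda>\<omega>. indicator K \<omega> * (indicator {..a} (B T \<omega>) * h (B T \<omega>))) =
      expectation (\<lambda>\<omega>. indicator K \<omega> * (indicator {..a} (2 * a - B T \<omega>) * h (2 * a - B T \<omega>)))"
    unfolding K_def by (rule reflection_expectation[OF T a, where h = "\<lambda>x. indicator {..a} x * h x"]) simp
  also have "\<dots> = expectation (\<lambda>\<omega>. indicator {a<..} (B T \<omega>) * h (2 * a - B T \<omega>))"
  proof (rule integral_cong_AE)
    \<comment> \<open>If the endpoint exceeds \<open>a\<close>, the time \<open>T\<close> itself
      witnesses \<open>K\<close>; the two indicators can differ only at the tie
      \<open>B T = a\<close>.\<close>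
    show "AE \<omega> in M. indicator K \<omega> * (indicator {..a} (2 * a - B T \<omega>) * h (2 * a - B T \<omega>)) =
        indicator {a<..} (B T \<omega>) * h (2 * a - B T \<omega>)"
      using distributed_AE_neq[OF distributed_B[OF T], of a] AE_space
      by eventually_elim (use T' in \<open>auto simp: K_def indicator_def\<close>)
  qed auto
  finally show ?thesis .
qed

end

subsection \<open>Moments of the path conditioned to stay below a level\<close>

text \<open>Integrating the pointwise inequality in \<open>y\<close> and then in \<open>x\<close> gives twice the claim.\<close>

lemma chebyshev_integral_ineq:
  fixes g p q :: "'a \<Rightarrow> real"
  assumes int: "integrable M p" "integrable M q" "integrable M (\<lambda>x. g x * p x)" "integrable M (\<lambda>x. g x * q x)"
    and mono: "\<And>x y. x \<in> space M \<Longrightarrow> y \<in> space M \<Longrightarrow> 0 \<le> (g y - g x) * (p y * q x - p x * q y)"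
  shows "(\<integral>x. p x \<partial>M) * (\<integral>x. g x * q x \<partial>M) \<le> (\<integral>x. g x * p x \<partial>M) * (\<integral>x. q x \<partial>M)"
proof -
  define P Q GP GQ where "P = (\<integral>x. p x \<partial>M)" "Q = (\<integral>x. q x \<partial>M)"
    "GP = (\<integral>x. g x * p x \<partial>M)" "GQ = (\<integral>x. g x * q x \<partial>M)"
  note defs = this
  have inner: "0 \<le> q x * GP - p x * GQ - (g x * q x) * P + (g x * p x) * Q" if x: "x \<in> space M" for x
  proof -
    have "0 \<le> (\<integral>y. (g y * p y) * q x - (g y * q y) * p x - p y * (g x * q x) + q y * (g x * p x) \<partial>M)"
      using mono[OF x] by (intro Bochner_Integration.integral_nonneg) (auto simp: algebra_simps)
    also have "\<dots> = q x * GP - p x * GQ - (g x * q x) * P + (g x * p x) * Q"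
      using int by (simp add: defs)
    finally show ?thesis .
  qed
  have "0 \<le> (\<integral>x. q x * GP - p x * GQ - (g x * q x) * P + (g x * p x) * Q \<partial>M)"
    using inner by (intro Bochner_Integration.integral_nonneg) auto
  also have "\<dots> = 2 * (GP * Q - P * GQ)"
    using int by (simp add: defs)
  finally show ?thesis by (simp add: defs)
qed

text \<open>Fubini for the product law. Both factors are pulled back to the same space, so the
  independent copy appears as a second sample point \<open>\<omega>'\<close>.\<close>

lemma (in prob_space) indep_var_integral:
  fixes H :: "'b \<times> 'b \<Rightarrow> real"
  assumes ind: "indep_var S X T Y" and H [measurable]: "H \<in> borel_measurable (S \<Otimes>\<^sub>M T)"
    and int: "integrable M (\<lambda>\<omega>. H (X \<omega>, Y \<omega>))"
  shows "expectation (\<lambda>\<omega>. H (X \<omega>, Y \<omega>)) = expectation (\<lambda>\<omega>. expectation (\<lambda>\<omega>'. H (X \<omega>, Y \<omega>')))"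
proof -
  have X [measurable]: "random_variable S X" and Y [measurable]: "random_variable T Y"
    using ind by (auto dest: indep_var_rv1 indep_var_rv2)
  let ?S = "distr M S X" and ?T = "distr M T Y"
  interpret S: prob_space ?S by (rule prob_space_distr) fact
  interpret T: prob_space ?T by (rule prob_space_distr) fact
  interpret ST: pair_prob_space ?S ?T ..
  have eq: "?S \<Otimes>\<^sub>M ?T = distr M (S \<Otimes>\<^sub>M T) (\<lambda>\<omega>. (X \<omega>, Y \<omega>))"
    using ind by (simp add: indep_var_distribution_eq)
  have "integrable (?S \<Otimes>\<^sub>M ?T) H"
    using int by (simp add: eq integrable_distr_eq)
  from ST.integral_fst'[OF this]
  have "expectation (\<lambda>\<omega>. H (X \<omega>, Y \<omega>)) = (\<integral>x. (\<integral>y. H (x, y) \<partial>?T) \<partial>?S)"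
    by (simp add: eq integral_distr)
  also have "\<dots> = expectation (\<lambda>\<omega>. (\<integral>y. H (X \<omega>, y) \<partial>?T))"
    by (subst integral_distr) (auto intro!: T.borel_measurable_lebesgue_integral)
  also have "\<dots> = expectation (\<lambda>\<omega>. expectation (\<lambda>\<omega>'. H (X \<omega>, Y \<omega>')))"
  proof (intro Bochner_Integration.integral_cong refl)
    fix \<omega> assume "\<omega> \<in> space M"
    then have [measurable]: "X \<omega> \<in> space S" by (rule measurable_space[OF X])
    show "(\<integral>y. H (X \<omega>, y) \<partial>?T) = expectation (\<lambda>\<omega>'. H (X \<omega>, Y \<omega>'))"
      by (rule integral_distr) auto
  qed
  finally show ?thesis .
qed

section \<open>Staying below a constant level\<close>

context standard_brownian_motion begin

definition stay :: "real \<Rightarrow> real \<Rightarrow> 'a set" where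
  "stay T a = {\<omega> \<in> space M. \<forall>t\<in>{0..T}. B t \<omega> \<le> a}"

lemma stay_events [measurable (raw)]: "0 \<le> T \<Longrightarrow> stay T a \<in> events"
  unfolding stay_def by (rule below_measurable) auto

lemma prob_stay_mono: "0 \<le> T \<Longrightarrow> a \<le> a' \<Longrightarrow> prob (stay T a) \<le> prob (stay T a')"
  by (intro finite_measure_mono stay_events) (auto simp: stay_def)

text \<open>Case \<open>h = 1\<close> of \<open>expectation_below\<close> together with the symmetry
  of \<open>B T\<close>. The density form serves the analytic comparisons below, the expectation
  form a second-moment bound in \<open>stay_moment\<close>.\<close>

lemma prob_stay_eq:
  assumes T: "0 < T" and a: "0 \<le> a"
  shows "prob (stay T a) = (\<integral>x. normal_density 0 (sqrt T) x * indicator {-a..a} x \<partial>lborel)"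
    and "prob (stay T a) = expectation (\<lambda>\<omega>. indicator {-a..a} (B T \<omega>))"
proof -
  note D = distributed_B[OF T]
  have [measurable]: "random_variable borel (B T)" using T by (intro random_variable) auto
  have "prob (stay T a) = expectation (\<lambda>\<omega>. indicator (stay T a) \<omega> * 1)"
    using T by (simp add: stay_events)
  also have "\<dots> = expectation (\<lambda>\<omega>. indicator {..a} (B T \<omega>) * 1) - expectation (\<lambda>\<omega>. indicator {a<..} (B T \<omega>) * 1)"
    unfolding stay_def by (rule expectation_below[OF T a, of "\<lambda>_. 1"]) auto
  also have "expectation (\<lambda>\<omega>. indicator {a<..} (B T \<omega>) * 1) = expectation (\<lambda>\<omega>. indicat_real {a<..} (- B T \<omega>))"
    using expectation_normal_symmetric[OF D, of "indicator {a<..}"] T by simp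
  also have "expectation (\<lambda>\<omega>. indicator {..a} (B T \<omega>) * 1) - \<dots> =
     expectation (\<lambda>\<omega>. indicator {..a} (B T \<omega>) - indicator {a<..} (- B T \<omega>))"
    by (subst Bochner_Integration.integral_diff)
       (auto intro!: integrable_const_bound[where B = 1] simp: indicator_def)
  also have "\<dots> = expectation (\<lambda>\<omega>. indicator {-a..a} (B T \<omega>))"
    using a by (intro Bochner_Integration.integral_cong) (auto simp: indicator_def)
  finally show *: "prob (stay T a) = expectation (\<lambda>\<omega>. indicator {-a..a} (B T \<omega>))" .
  show "prob (stay T a) = (\<integral>x. normal_density 0 (sqrt T) x * indicator {-a..a} x \<partial>lborel)"
    unfolding * by (rule distributed_integral[OF D, symmetric]) auto
qed

text \<open>For \<open>T > 0\<close>, \<open>prob (stay T y) / y\<close> is twice the mean of the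
  Gaussian density over \<open>{-y..y}\<close>, and the density decreases away from
  \<open>0\<close>. The cross-multiplied form includes \<open>x = 0\<close>; \<open>T = 0\<close> is
  included because the remaining time may vanish.\<close>

lemma prob_stay_scale:
  assumes T: "0 \<le> T" and x: "0 \<le> x" "x \<le> y"
  shows "x * prob (stay T y) \<le> y * prob (stay T x)"
proof (cases "T = 0")
  case True
  then have "stay T z = space M" if "z \<ge> 0" for z using that by (auto simp: stay_def start_zero)
  then show ?thesis using x by (simp add: prob_space)
next
  case False
  then have T: "T > 0" using assms by simp
  show ?thesis
  proof (cases "x = 0")
    case True then show ?thesis using x by (simp add: measure_nonneg)
  next
    case False
    then have x0: "x > 0" "y > 0" using x by auto
    define c where "c = x / y"
    have c: "0 < c" "c \<le> 1" using x x0 by (auto simp: c_def)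
    let ?\<phi> = "normal_density 0 (sqrt T)"
    have "-x = c * (-y)" "x = c * y" using x0 by (auto simp: c_def)
    then have ind: "indicator {-x..x} (c * z) = indicat_real {-y..y} z" for z
      using c by (simp only: indicator_def atLeastAtMost_iff mult_le_cancel_left_pos)
    have int: "integrable lborel (\<lambda>z. ?\<phi> z * indicator {-r..r} z)" for r
      using T by (intro integrable_real_mult_indicator) auto
    have int': "integrable lborel (\<lambda>z. ?\<phi> (c * z) * indicator {-y..y} z)"
      using lborel_integrable_real_affine[OF int[of x], of c 0] c by (simp add: ind)
    have "prob (stay T x) = (\<integral>z. ?\<phi> z * indicator {-x..x} z \<partial>lborel)"
      using T x by (intro prob_stay_eq) auto
    also have "\<dots> = \<bar>c\<bar> *\<^sub>R (\<integral>z. ?\<phi> (0 + c * z) * indicator {-x..x} (0 + c * z) \<partial>lborel)"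
      using c by (intro lborel_integral_real_affine) auto
    also have "\<dots> = c * (\<integral>z. ?\<phi> (c * z) * indicator {-y..y} z \<partial>lborel)"
      using c by (simp add: ind)
    also have "\<dots> \<ge> c * (\<integral>z. ?\<phi> z * indicator {-y..y} z \<partial>lborel)"
    proof (intro mult_left_mono integral_mono int int')
      fix z
      have "(c * z)\<^sup>2 \<le> 1 * z\<^sup>2"
        unfolding power_mult_distrib using c by (intro mult_right_mono) (auto simp: power_le_one)
      then have "?\<phi> z \<le> ?\<phi> (c * z)"
        using T by (auto simp: normal_density_def intro!: divide_right_mono)
      then show "?\<phi> z * indicator {-y..y} z \<le> ?\<phi> (c * z) * indicator {-y..y} z"
        by (intro mult_right_mono) auto
    qed (use c in auto)
    also have "(\<integral>z. ?\<phi> z * indicator {-y..y} z \<partial>lborel) = prob (stay T y)"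
      using T x by (intro prob_stay_eq[symmetric]) auto
    finally have "c * prob (stay T y) \<le> prob (stay T x)" .
    then show ?thesis using x0 by (simp add: c_def field_simps)
  qed
qed

text \<open>On \<open>{-a..a}\<close> the Gaussian density lies between its value at
  \<open>a\<close> and its value at \<open>0\<close>. This is the source of the order
  \<open>T powr (- 1 / 2)\<close>.\<close>

lemma prob_stay_bounds:
  assumes T: "0 < T" and a: "0 \<le> a"
  shows "prob (stay T a) \<le> 2 * a / sqrt (2 * pi * T)"
    and "2 * a / sqrt (2 * pi * T) * exp (- a\<^sup>2 / (2 * T)) \<le> prob (stay T a)"
proof -
  let ?\<phi> = "normal_density 0 (sqrt T)"
  have int: "integrable lborel (\<lambda>z. ?\<phi> z * indicator {-a..a} z)"
    using T by (intro integrable_real_mult_indicator) auto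
  have intc: "integrable lborel (\<lambda>z. c * indicat_real {-a..a} z)" for c :: real
    by (intro integrable_mult_right) (auto simp: integrable_indicator_iff emeasure_lborel_Icc_eq)
  have val: "(\<integral>z. c * indicat_real {-a..a} z \<partial>lborel) = 2 * a * c" for c :: real
    using a by simp
  have "prob (stay T a) \<le> (\<integral>z. 1 / sqrt (2 * pi * T) * indicat_real {-a..a} z \<partial>lborel)"
    unfolding prob_stay_eq(1)[OF T a]
    using T by (intro integral_mono int intc mult_right_mono) (auto simp: normal_density_def divide_right_mono)
  then show "prob (stay T a) \<le> 2 * a / sqrt (2 * pi * T)" unfolding val by simp
  have "(\<integral>z. exp (- a\<^sup>2 / (2 * T)) / sqrt (2 * pi * T) * indicat_real {-a..a} z \<partial>lborel) \<le> prob (stay T a)"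
    unfolding prob_stay_eq(1)[OF T a]
  proof (intro integral_mono int intc)
    fix z
    show "exp (- a\<^sup>2 / (2 * T)) / sqrt (2 * pi * T) * indicat_real {-a..a} z \<le> ?\<phi> z * indicator {-a..a} z"
    proof (cases "z \<in> {-a..a}")
      case True
      then have "z\<^sup>2 \<le> a\<^sup>2" by (intro abs_le_square_iff[THEN iffD1]) auto
      then show ?thesis using T True by (auto simp: normal_density_def intro!: divide_right_mono)
    qed auto
  qed
  then show "2 * a / sqrt (2 * pi * T) * exp (- a\<^sup>2 / (2 * T)) \<le> prob (stay T a)"
    unfolding val by simp
qed

lemma prob_stay_pos:
  assumes "0 < T" "0 < a"
  shows "0 < prob (stay T a)"
  by (rule less_le_trans[OF _ prob_stay_bounds(2)]) (use assms in auto)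

text \<open>The increments over \<open>{0..s}\<close> and over \<open>{s..s+t}\<close> are sampled on separate \<open>n\<close>-step grids.\<close>

lemma markov_grid:
  fixes h :: "real \<Rightarrow> real"
  assumes s: "0 < s" and t: "0 \<le> t" and n: "0 < n" and h [measurable]: "h \<in> borel_measurable borel"
    and int: "integrable M (\<lambda>\<omega>. h (B s \<omega>))"
  shows "expectation (\<lambda>\<omega>. h (B s \<omega>) * of_bool (\<forall>k\<le>n. B (real k * s / real n) \<omega> \<le> a) *
       of_bool (\<forall>k\<le>n. B (s + real k * t / real n) \<omega> - B s \<omega> \<le> a - B s \<omega>)) =
    expectation (\<lambda>\<omega>. h (B s \<omega>) * of_bool (\<forall>k\<le>n. B (real k * s / real n) \<omega> \<le> a) *
       prob {\<omega>' \<in> space M. \<forall>k\<le>n. B (s + real k * t / real n) \<omega>' - B s \<omega>' \<le> a - B s \<omega>})"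
proof -
  \<comment> \<open>The two grids are concatenated into \<open>2 * n\<close> steps meeting at
    \<open>s\<close>, so that past and future become disjoint blocks of one independent family. For
    \<open>t = 0\<close> the second block of times is constant, which the non-strict order in
    \<open>indep_increments\<close> permits.\<close>
  define \<tau> where "\<tau> i = (if i \<le> n then real i * s / real n else s + real (i - n) * t / real n)" for i
  have \<tau>1: "\<tau> i = real i * s / real n" if "i \<le> n" for i using that by (simp add: \<tau>_def)
  have \<tau>2: "\<tau> (n + i) = s + real i * t / real n" for i using n by (cases "i = 0") (auto simp: \<tau>_def)
  have \<tau>_mono: "\<tau> i \<le> \<tau> (Suc i)" for i
  proof (cases "i < n")
    case True
    then show ?thesis using s n by (auto simp: \<tau>1 divide_simps mult_right_mono)
  next
    case False
    then obtain j where j: "i = n + j" by (metis le_iff_add not_less)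
    have "real j * t / real n \<le> real (Suc j) * t / real n"
      using t by (intro divide_right_mono mult_right_mono) auto
    then show ?thesis using \<tau>2[of j] \<tau>2[of "Suc j"] j by simp
  qed
  have \<tau>0: "\<tau> 0 = 0" by (simp add: \<tau>1)
  have \<tau>_nonneg: "0 \<le> \<tau> i" for i
    using s t by (auto simp: \<tau>_def)
  define X where "X i \<omega> = B (\<tau> (Suc i)) \<omega> - B (\<tau> i) \<omega>" for i \<omega>
  have ind: "indep_vars (\<lambda>_. borel) X {..<n + n}"
    unfolding X_def by (rule indep_increments) (use \<tau>0 \<tau>_mono in auto)
  define P where "P = (\<Pi>\<^sub>M i\<in>{..<n}. (borel :: real measure))"
  define Q where "Q = (\<Pi>\<^sub>M i\<in>{n..<n+n}. (borel :: real measure))"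
  define U where "U \<omega> = (\<lambda>i\<in>{..<n}. X i \<omega>)" for \<omega>
  define V where "V \<omega> = (\<lambda>i\<in>{n..<n+n}. X i \<omega>)" for \<omega>
  have UV: "indep_var P U Q V"
    unfolding P_def Q_def U_def V_def by (rule indep_var_restrict[OF ind]) auto
  have sumU: "(\<Sum>i<k. U \<omega> i) = B (real k * s / real n) \<omega>" if "k \<le> n" "\<omega> \<in> space M" for k \<omega>
  proof -
    have "(\<Sum>i<k. U \<omega> i) = (\<Sum>i<k. X i \<omega>)" using that by (intro sum.cong) (auto simp: U_def)
    also have "\<dots> = B (\<tau> k) \<omega>"
      unfolding X_def using that
      by (subst sum_lessThan_telescope[where f = "\<lambda>i. B (\<tau> i) \<omega>"]) (simp add: \<tau>0 start_zero)
    finally show ?thesis using that by (simp add: \<tau>1)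
  qed
  have sumUn: "(\<Sum>i<n. U \<omega> i) = B s \<omega>" if "\<omega> \<in> space M" for \<omega>
    using sumU[of n \<omega>] that n by simp
  have sumV: "(\<Sum>i\<in>{n..<n+k}. V \<omega> i) = B (s + real k * t / real n) \<omega> - B s \<omega>" if "k \<le> n" for k \<omega>
  proof -
    have "(\<Sum>i\<in>{n..<n+k}. V \<omega> i) = (\<Sum>i\<in>{n..<n+k}. X i \<omega>)"
      using that by (intro sum.cong) (auto simp: V_def)
    also have "\<dots> = B (\<tau> (n + k)) \<omega> - B (\<tau> n) \<omega>"
      unfolding X_def by (rule sum_Suc_diff'[where f = "\<lambda>i. B (\<tau> i) \<omega>"]) simp
    finally show ?thesis using \<tau>2[of 0] by (simp add: \<tau>2)
  qed
  define H where "H p = (case p of (u, v) \<Rightarrow> h (\<Sum>i<n. u i) * of_bool (\<forall>k\<in>{..n}. (\<Sum>i<k. u i) \<le> a) *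
    of_bool (\<forall>k\<in>{..n}. (\<Sum>i\<in>{n..<n+k}. v i) \<le> a - (\<Sum>i<n. u i)))" for p :: "(nat \<Rightarrow> real) \<times> (nat \<Rightarrow> real)"
  have [measurable]: "(\<lambda>u. \<Sum>i<k. u i) \<in> borel_measurable P" if "k \<in> {..n}" for k
    unfolding P_def using that by (intro borel_measurable_sum measurable_component_singleton) auto
  have mn [measurable]: "(\<lambda>u. \<Sum>i<n. u i) \<in> borel_measurable P"
    unfolding P_def by (intro borel_measurable_sum measurable_component_singleton) auto
  have [measurable]: "(\<lambda>v. \<Sum>i\<in>{n..<n+k}. v i) \<in> borel_measurable Q" if "k \<in> {..n}" for k
    unfolding Q_def using that by (intro borel_measurable_sum measurable_component_singleton) auto
  have [measurable]: "Measurable.pred (P \<Otimes>\<^sub>M Q) (\<lambda>p. \<forall>k\<in>{..n}. (\<Sum>i<k. fst p i) \<le> a)"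
    by (rule pred_intros_finite) (auto, measurable)
  have [measurable]: "Measurable.pred (P \<Otimes>\<^sub>M Q) (\<lambda>p. \<forall>k\<in>{..n}. (\<Sum>i\<in>{n..<n+k}. snd p i) \<le> a - (\<Sum>i<n. fst p i))"
    by (rule pred_intros_finite) (auto, measurable)
  have H: "H \<in> borel_measurable (P \<Otimes>\<^sub>M Q)"
    unfolding H_def case_prod_beta by measurable
  have HUV: "H (U \<omega>, V \<omega>') = h (B s \<omega>) * of_bool (\<forall>k\<le>n. B (real k * s / real n) \<omega> \<le> a) *
       of_bool (\<forall>k\<le>n. B (s + real k * t / real n) \<omega>' - B s \<omega>' \<le> a - B s \<omega>)"
    if "\<omega> \<in> space M" "\<omega>' \<in> space M" for \<omega> \<omega>'
    using n unfolding H_def by (simp add: sumU sumUn sumV that Ball_def cong: conj_cong imp_cong)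
  have Um [measurable]: "random_variable P U" and Vm [measurable]: "random_variable Q V"
    using UV by (auto dest: indep_var_rv1 indep_var_rv2)
  have intH: "integrable M (\<lambda>\<omega>. H (U \<omega>, V \<omega>))"
  proof (rule Bochner_Integration.integrable_bound[OF int])
    show "(\<lambda>\<omega>. H (U \<omega>, V \<omega>)) \<in> borel_measurable M" using H by measurable
    show "AE \<omega> in M. norm (H (U \<omega>, V \<omega>)) \<le> norm (h (B s \<omega>))"
      by (intro AE_I2) (auto simp: HUV)
  qed
  have "expectation (\<lambda>\<omega>. H (U \<omega>, V \<omega>)) = expectation (\<lambda>\<omega>. expectation (\<lambda>\<omega>'. H (U \<omega>, V \<omega>')))"
    by (rule indep_var_integral[OF UV H intH])
  also have "\<dots> = expectation (\<lambda>\<omega>. h (B s \<omega>) * of_bool (\<forall>k\<le>n. B (real k * s / real n) \<omega> \<le> a) *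
       prob {\<omega>' \<in> space M. \<forall>k\<le>n. B (s + real k * t / real n) \<omega>' - B s \<omega>' \<le> a - B s \<omega>})"
  proof (intro Bochner_Integration.integral_cong refl)
    fix \<omega> assume \<omega>: "\<omega> \<in> space M"
    let ?S = "{\<omega>' \<in> space M. \<forall>k\<le>n. B (s + real k * t / real n) \<omega>' - B s \<omega>' \<le> a - B s \<omega>}"
    have [measurable]: "random_variable borel (B s)" "random_variable borel (B (s + real k * t / real n))" for k
      using s t by (auto intro!: random_variable)
    have "?S = {\<omega>' \<in> space M. \<forall>k\<in>{..n}. B (s + real k * t / real n) \<omega>' - B s \<omega>' \<le> a - B s \<omega>}" by auto
    also have "\<dots> \<in> events" by measurable
    finally have S: "?S \<in> events" .
    have "expectation (\<lambda>\<omega>'. H (U \<omega>, V \<omega>')) =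
      expectation (\<lambda>\<omega>'. h (B s \<omega>) * of_bool (\<forall>k\<le>n. B (real k * s / real n) \<omega> \<le> a) * indicator ?S \<omega>')"
      by (intro Bochner_Integration.integral_cong refl) (auto simp: HUV \<omega>)
    also have "\<dots> = h (B s \<omega>) * of_bool (\<forall>k\<le>n. B (real k * s / real n) \<omega> \<le> a) * prob ?S"
      using S by simp
    finally show "expectation (\<lambda>\<omega>'. H (U \<omega>, V \<omega>')) =
      h (B s \<omega>) * of_bool (\<forall>k\<le>n. B (real k * s / real n) \<omega> \<le> a) * prob ?S" .
  qed
  also have "expectation (\<lambda>\<omega>. H (U \<omega>, V \<omega>)) = expectation (\<lambda>\<omega>. h (B s \<omega>) * of_bool (\<forall>k\<le>n. B (real k * s / real n) \<omega> \<le> a) *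
       of_bool (\<forall>k\<le>n. B (s + real k * t / real n) \<omega> - B s \<omega> \<le> a - B s \<omega>))"
    by (intro Bochner_Integration.integral_cong refl) (simp add: HUV)
  finally show ?thesis .
qed

text \<open>Limit of \<open>markov_grid\<close>: the grid indicators and the grid versions
  \<open>un\<close> of \<open>u\<close> converge pointwise, and \<open>\<bar>h (B s)\<bar>\<close>
  dominates both sides. No continuity of \<open>u\<close> enters, since \<open>un\<close> is
  evaluated at a fixed argument for each path.\<close>

lemma markov_stay:
  fixes h :: "real \<Rightarrow> real"
  assumes s: "0 < s" and t: "0 \<le> t" and h [measurable]: "h \<in> borel_measurable borel"
    and int: "integrable M (\<lambda>\<omega>. h (B s \<omega>))"
  defines "u \<equiv> \<lambda>y. prob {\<omega> \<in> space M. \<forall>r\<in>{0..t}. B (s + r) \<omega> - B s \<omega> \<le> y}"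
  shows "expectation (\<lambda>\<omega>. indicator (stay (s + t) a) \<omega> * h (B s \<omega>)) =
    expectation (\<lambda>\<omega>. indicator (stay s a) \<omega> * h (B s \<omega>) * u (a - B s \<omega>))"
proof -
  interpret W: standard_brownian_motion M "\<lambda>r \<omega>. B (s + r) \<omega> - B s \<omega>"
    using s by (intro restart) simp
  have [measurable]: "random_variable borel (B s)" "random_variable borel (B (s + real k * t / real n))"
    "random_variable borel (B (real k * s / real n))" for k n
    using s t by (auto intro!: random_variable)
  define g1 where "g1 n \<omega> = (\<forall>k\<le>n. B (real k * s / real n) \<omega> \<le> a)" for n \<omega>
  define g2 where "g2 n \<omega> = (\<forall>k\<le>n. B (s + real k * t / real n) \<omega> - B s \<omega> \<le> a - B s \<omega>)" for n \<omega>
  define un where "un n y = prob {\<omega> \<in> space M. \<forall>k\<le>n. B (s + real k * t / real n) \<omega> - B s \<omega> \<le> y}" for n y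
  have S: "{\<omega> \<in> space M. \<forall>k\<le>n. B (s + real k * t / real n) \<omega> - B s \<omega> \<le> y} \<in> events" for n y
  proof -
    have "{\<omega> \<in> space M. \<forall>k\<le>n. B (s + real k * t / real n) \<omega> - B s \<omega> \<le> y} =
      {\<omega> \<in> space M. \<forall>k\<in>{..n}. B (s + real k * t / real n) \<omega> - B s \<omega> \<le> y}" by auto
    then show ?thesis by simp
  qed
  have S': "{\<omega> \<in> space M. \<forall>r\<in>{0..t}. B (s + r) \<omega> - B s \<omega> \<le> y} \<in> events" for y
    using t by (intro W.below_measurable) auto
  have un_le: "un n y \<le> 1" "0 \<le> un n y" for n y by (auto simp: un_def)
  have [measurable]: "un n \<in> borel_measurable borel" for n
    by (rule borel_measurable_mono) (auto simp: mono_def un_def intro!: finite_measure_mono S intro: order_trans)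
  have [measurable]: "u \<in> borel_measurable borel"
    by (rule borel_measurable_mono) (auto simp: mono_def u_def intro!: finite_measure_mono S' intro: order_trans)
  have un_lim: "(\<lambda>n. un n y) \<longlonglongrightarrow> u y" for y
    unfolding un_def u_def
  proof (rule prob_LIMSEQ_eventually[OF S S'], intro AE_I2)
    fix \<omega> assume \<omega>: "\<omega> \<in> space M"
    have "(\<lambda>n. of_bool (\<forall>k\<le>n. B (s + real k * t / real n) \<omega> - B s \<omega> \<le> y) :: real)
           \<longlonglongrightarrow> of_bool (\<forall>r\<in>{0..t}. B (s + r) \<omega> - B s \<omega> \<le> y)" (is "?f \<longlonglongrightarrow> ?l")
      by (rule W.below_LIMSEQ[OF _ t \<omega>]) auto
    \<comment> \<open>A sequence of zeros and ones that comes within \<open>1/2\<close> of its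
      limit, itself zero or one, agrees with it.\<close>
    from order_tendstoD(1)[OF this, of "?l - 1/2"] order_tendstoD(2)[OF this, of "?l + 1/2"]
    have "\<forall>\<^sub>F n in sequentially. ?f n > ?l - 1/2" "\<forall>\<^sub>F n in sequentially. ?f n < ?l + 1/2" by auto
    then show "\<forall>\<^sub>F n in sequentially.
        \<omega> \<in> {\<omega> \<in> space M. \<forall>k\<le>n. B (s + real k * t / real n) \<omega> - B s \<omega> \<le> y} \<longleftrightarrow>
        \<omega> \<in> {\<omega> \<in> space M. \<forall>r\<in>{0..t}. B (s + r) \<omega> - B s \<omega> \<le> y}"
      by eventually_elim (use \<omega> in \<open>auto simp: of_bool_def split: if_splits\<close>)
  qed
  have g_meas [measurable]: "Measurable.pred M (g1 n)" "Measurable.pred M (g2 n)" for n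
  proof -
    have "g1 n = (\<lambda>\<omega>. \<forall>k\<in>{..n}. B (real k * s / real n) \<omega> \<le> a)"
      "g2 n = (\<lambda>\<omega>. \<forall>k\<in>{..n}. B (s + real k * t / real n) \<omega> - B s \<omega> \<le> a - B s \<omega>)"
      by (auto simp: g1_def g2_def)
    then show "Measurable.pred M (g1 n)" "Measurable.pred M (g2 n)" by simp_all
  qed
  have lim1: "(\<lambda>n. of_bool (g1 n \<omega>)) \<longlonglongrightarrow> indicat_real (stay s a) \<omega>" if "\<omega> \<in> space M" for \<omega>
    using below_LIMSEQ[of s "\<lambda>_. a", OF _ _ that] s that by (simp add: g1_def stay_def indicator_def)
  have lim2: "(\<lambda>n. of_bool (g2 n \<omega>) :: real) \<longlonglongrightarrow> of_bool (\<forall>r\<in>{0..t}. B (s + r) \<omega> - B s \<omega> \<le> a - B s \<omega>)"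
    if "\<omega> \<in> space M" for \<omega>
    unfolding g2_def using W.below_LIMSEQ[of t "\<lambda>_. a - B s \<omega>", OF _ t that] by simp
  have stay_split: "indicat_real (stay (s + t) a) \<omega> =
     indicator (stay s a) \<omega> * of_bool (\<forall>r\<in>{0..t}. B (s + r) \<omega> - B s \<omega> \<le> a - B s \<omega>)"
    if "\<omega> \<in> space M" for \<omega>
  proof -
    have "(\<forall>r\<in>{0..s + t}. B r \<omega> \<le> a) \<longleftrightarrow> (\<forall>r\<in>{0..s}. B r \<omega> \<le> a) \<and> (\<forall>r\<in>{0..t}. B (s + r) \<omega> \<le> a)"
    proof safe
      fix r assume *: "\<forall>r\<in>{0..s}. B r \<omega> \<le> a" "\<forall>r\<in>{0..t}. B (s + r) \<omega> \<le> a" "r \<in> {0..s+t}"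
      show "B r \<omega> \<le> a"
        using *(1) *(3) bspec[OF *(2), of "r - s"] by (cases "r \<le> s") auto
    qed (use s t in auto)
    then show ?thesis using that by (auto simp: stay_def indicator_def)
  qed
  have st: "stay s a \<in> events" "stay (s + t) a \<in> events" using s t by (auto intro: stay_events)
  note st [measurable]
  let ?l = "\<lambda>n. expectation (\<lambda>\<omega>. h (B s \<omega>) * of_bool (g1 n \<omega>) * of_bool (g2 n \<omega>))"
  let ?r = "\<lambda>n. expectation (\<lambda>\<omega>. h (B s \<omega>) * of_bool (g1 n \<omega>) * un n (a - B s \<omega>))"
  have L: "?l \<longlonglongrightarrow> expectation (\<lambda>\<omega>. indicator (stay (s + t) a) \<omega> * h (B s \<omega>))"
  proof (rule integral_dominated_convergence[where w = "\<lambda>\<omega>. \<bar>h (B s \<omega>)\<bar>"])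
    show "AE \<omega> in M. (\<lambda>n. h (B s \<omega>) * of_bool (g1 n \<omega>) * of_bool (g2 n \<omega>))
        \<longlonglongrightarrow> indicator (stay (s + t) a) \<omega> * h (B s \<omega>)"
    proof (intro AE_I2)
      fix \<omega> assume \<omega>: "\<omega> \<in> space M"
      show "(\<lambda>n. h (B s \<omega>) * of_bool (g1 n \<omega>) * of_bool (g2 n \<omega>))
        \<longlonglongrightarrow> indicator (stay (s + t) a) \<omega> * h (B s \<omega>)"
        using tendsto_mult[OF tendsto_mult[OF tendsto_const lim1[OF \<omega>]] lim2[OF \<omega>], of "h (B s \<omega>)"]
        by (simp add: stay_split[OF \<omega>] ac_simps)
    qed
  qed (use int in auto)
  have R: "?r \<longlonglongrightarrow> expectation (\<lambda>\<omega>. indicator (stay s a) \<omega> * h (B s \<omega>) * u (a - B s \<omega>))"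
  proof (rule integral_dominated_convergence[where w = "\<lambda>\<omega>. \<bar>h (B s \<omega>)\<bar>"])
    show "AE \<omega> in M. (\<lambda>n. h (B s \<omega>) * of_bool (g1 n \<omega>) * un n (a - B s \<omega>))
        \<longlonglongrightarrow> indicator (stay s a) \<omega> * h (B s \<omega>) * u (a - B s \<omega>)"
    proof (intro AE_I2)
      fix \<omega> assume \<omega>: "\<omega> \<in> space M"
      show "(\<lambda>n. h (B s \<omega>) * of_bool (g1 n \<omega>) * un n (a - B s \<omega>))
        \<longlonglongrightarrow> indicator (stay s a) \<omega> * h (B s \<omega>) * u (a - B s \<omega>)"
        using tendsto_mult[OF tendsto_mult[OF tendsto_const lim1[OF \<omega>]] un_lim[of "a - B s \<omega>"], of "h (B s \<omega>)"]
        by (simp add: ac_simps)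
    qed
    show "AE \<omega> in M. norm (h (B s \<omega>) * of_bool (g1 n \<omega>) * un n (a - B s \<omega>)) \<le> \<bar>h (B s \<omega>)\<bar>" for n
      using un_le by (intro AE_I2) (auto simp: abs_mult intro!: mult_left_le)
  qed (use int in auto)
  have "\<forall>\<^sub>F n in sequentially. ?r n = ?l n"
    using eventually_gt_at_top[of 0]
    by eventually_elim (simp only: g1_def g2_def un_def markov_grid[OF s t _ h int])
  from LIMSEQ_unique[OF L Lim_transform_eventually[OF R this]] show ?thesis .
qed

text \<open>The Markov property reduces the law given survival up to \<open>T\<close> to the law at
  time \<open>s\<close> weighted by \<open>u (a - B s)\<close>. Monotonicity of \<open>u\<close>
  handles the positive part, monotonicity of \<open>y / u y\<close> the negative part.\<close>

lemma stay_moment: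
  assumes a: "0 < a" and s: "0 \<le> s" "s \<le> T"
  shows "expectation (\<lambda>\<omega>. indicator (stay T a) \<omega> * \<bar>B s \<omega>\<bar>) \<le> 6 * sqrt s * prob (stay T a)"
proof (cases "s = 0")
  case True
  then have "expectation (\<lambda>\<omega>. indicator (stay T a) \<omega> * \<bar>B s \<omega>\<bar>) = expectation (\<lambda>\<omega>. 0)"
    by (intro Bochner_Integration.integral_cong) (auto simp: start_zero)
  then show ?thesis using True by simp
next
  case False
  then have s: "0 < s" "s \<le> T" "0 \<le> T - s" using s by auto
  interpret W: standard_brownian_motion M "\<lambda>r \<omega>. B (s + r) \<omega> - B s \<omega>"
    using s by (intro restart) simp
  define u where "u y = prob {\<omega> \<in> space M. \<forall>r\<in>{0..T - s}. B (s + r) \<omega> - B s \<omega> \<le> y}" for y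
  have u_eq: "u y = prob (W.stay (T - s) y)" for y by (simp add: u_def W.stay_def)
  have u_mono: "u x \<le> u y" if "x \<le> y" for x y
    unfolding u_eq using that s by (intro W.prob_stay_mono) auto
  have u_scale: "x * u y \<le> y * u x" if "0 \<le> x" "x \<le> y" for x y
    unfolding u_eq using that s by (intro W.prob_stay_scale) auto
  have u01: "0 \<le> u y" "u y \<le> 1" for y by (auto simp: u_eq)
  have u_abs: "\<bar>v * u y\<bar> \<le> \<bar>v\<bar>" for v y
    using u01[of y] by (simp add: abs_mult mult_left_le)
  have [measurable]: "u \<in> borel_measurable borel"
    by (rule borel_measurable_mono) (auto simp: mono_def u_mono)
  have Bs [measurable]: "random_variable borel (B s)" using s by (intro random_variable) auto
  have st [measurable]: "stay s a \<in> events" "stay T a \<in> events" using s by (auto intro: stay_events)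
  note D = distributed_B[OF s(1)]
  have iB: "integrable M (B s)" and iB2: "integrable M (\<lambda>\<omega>. (B s \<omega>)\<^sup>2)"
    and eB: "expectation (B s) = 0" and eB2: "expectation (\<lambda>\<omega>. (B s \<omega>)\<^sup>2) = s"
    and eabs: "expectation (\<lambda>\<omega>. \<bar>B s \<omega>\<bar>) \<le> sqrt s"
    using normal_moments[OF D] s by simp_all
  define A where "A = stay s a"
  have A [measurable]: "A \<in> events" by (simp add: A_def)
  have A_le: "B s \<omega> \<le> a" if "\<omega> \<in> A" for \<omega> using that s by (auto simp: A_def stay_def)
  have markov: "expectation (\<lambda>\<omega>. indicator (stay T a) \<omega> * h (B s \<omega>)) =
      expectation (\<lambda>\<omega>. indicator A \<omega> * h (B s \<omega>) * u (a - B s \<omega>))"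
    if "h \<in> borel_measurable borel" "integrable M (\<lambda>\<omega>. h (B s \<omega>))" for h :: "real \<Rightarrow> real"
    using markov_stay[OF s(1,3) that, of a] by (simp add: A_def u_def)
  have PT: "expectation (\<lambda>\<omega>. indicator A \<omega> * u (a - B s \<omega>)) = prob (stay T a)"
  proof -
    have "prob (stay T a) = expectation (\<lambda>\<omega>. indicator (stay T a) \<omega> * 1)" using st(2) by simp
    also have "\<dots> = expectation (\<lambda>\<omega>. indicator A \<omega> * 1 * u (a - B s \<omega>))"
      by (rule markov) auto
    finally show ?thesis by simp
  qed
  have iAu: "integrable M (\<lambda>\<omega>. indicator A \<omega> * u (a - B s \<omega>))"
    using u01 by (intro integrable_const_bound[where B = 1]) (auto simp: indicator_def)
  have iBh: "integrable M (\<lambda>\<omega>. h (B s \<omega>))"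
    if [measurable]: "h \<in> borel_measurable borel" and "\<And>x. \<bar>h x\<bar> \<le> c * x\<^sup>2 + d * \<bar>x\<bar> + e" for h :: "real \<Rightarrow> real" and c d e
  proof (rule Bochner_Integration.integrable_bound)
    show "integrable M (\<lambda>\<omega>. c * (B s \<omega>)\<^sup>2 + d * \<bar>B s \<omega>\<bar> + e)" using iB iB2 by simp
    show "AE \<omega> in M. norm (h (B s \<omega>)) \<le> norm (c * (B s \<omega>)\<^sup>2 + d * \<bar>B s \<omega>\<bar> + e)"
      using order_trans[OF that(2) abs_ge_self] by (intro AE_I2) simp
  qed simp
  have iA: "integrable M (\<lambda>\<omega>. indicator A \<omega> * f \<omega>)" if "integrable M f" for f :: "'a \<Rightarrow> real"
    using integrable_mult_indicator[OF A that] by simp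

  define m where "m x = max 0 (- x)" for x :: real
  have m_meas [measurable]: "m \<in> borel_measurable borel" unfolding m_def by simp
  have m_le: "\<bar>m x\<bar> \<le> 0 * x\<^sup>2 + 1 * \<bar>x\<bar> + 0" for x by (simp add: m_def)
  have mY_le: "\<bar>m x * (a - x)\<bar> \<le> 1 * x\<^sup>2 + a * \<bar>x\<bar> + 0" for x
  proof (cases "x < 0")
    case True
    then have "m x * (a - x) = x\<^sup>2 + a * \<bar>x\<bar>" by (simp add: m_def power2_eq_square algebra_simps)
    then show ?thesis using a by simp
  qed (use a in \<open>auto simp: m_def\<close>)
  have m2Y_le: "\<bar>m (2 * a - x) * (a - (2 * a - x))\<bar> \<le> 1 * x\<^sup>2 + 0 * \<bar>x\<bar> + 0" for x
  proof (cases "2 * a < x")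
    case True
    then have "(x - 2 * a) * (x - a) \<le> x * x" using a by (intro mult_mono) auto
    then show ?thesis using True a by (simp add: m_def power2_eq_square abs_mult)
  qed (auto simp: m_def)
  have neg: "expectation (\<lambda>\<omega>. indicator (stay T a) \<omega> * m (B s \<omega>)) \<le> 4 * sqrt s * prob (stay T a)"
  proof -
    \<comment> \<open>The stopped-martingale identity: the distance to the level, killed at the
      level, keeps its initial mean \<open>a\<close>. Here it comes from reflection instead of
      optional stopping.\<close>
    have "expectation (\<lambda>\<omega>. indicator A \<omega> * (a - B s \<omega>)) =
        expectation (\<lambda>\<omega>. indicator {..a} (B s \<omega>) * (a - B s \<omega>))
        - expectation (\<lambda>\<omega>. indicator {a<..} (B s \<omega>) * (a - (2 * a - B s \<omega>)))"
      unfolding A_def stay_def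
      using iB s a by (intro expectation_below[where h = "\<lambda>x. a - x"]) auto
    also have "\<dots> = expectation (\<lambda>\<omega>. indicator {..a} (B s \<omega>) * (a - B s \<omega>) - indicator {a<..} (B s \<omega>) * (a - (2 * a - B s \<omega>)))"
      by (rule Bochner_Integration.integral_diff[symmetric];
          rule Bochner_Integration.integrable_bound[where f = "\<lambda>\<omega>. \<bar>B s \<omega>\<bar> + a"])
         (use iB a in \<open>auto simp: indicator_def\<close>)
    also have "\<dots> = expectation (\<lambda>\<omega>. a - B s \<omega>)"
      by (intro Bochner_Integration.integral_cong) (auto simp: indicator_def)
    also have "\<dots> = a" using iB by (simp add: eB prob_space)
    finally have EY: "expectation (\<lambda>\<omega>. indicator A \<omega> * (a - B s \<omega>)) = a" .

    define k where "k x = max 0 x * (a + x) - indicator {a<..} x * (m (2 * a - x) * (x - a))" for x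
    have "expectation (\<lambda>\<omega>. indicator A \<omega> * (m (B s \<omega>) * (a - B s \<omega>))) =
        expectation (\<lambda>\<omega>. indicator {..a} (B s \<omega>) * (m (B s \<omega>) * (a - B s \<omega>)))
        - expectation (\<lambda>\<omega>. indicator {a<..} (B s \<omega>) * (m (2 * a - B s \<omega>) * (a - (2 * a - B s \<omega>))))"
      unfolding A_def stay_def
    proof (rule expectation_below[where h = "\<lambda>x. m x * (a - x)"])
      show "integrable M (\<lambda>\<omega>. m (B s \<omega>) * (a - B s \<omega>))" by (rule iBh[OF _ mY_le]) simp
      show "integrable M (\<lambda>\<omega>. m (2 * a - B s \<omega>) * (a - (2 * a - B s \<omega>)))"
        by (rule iBh[OF _ m2Y_le]) simp
    qed (use s a in auto)
    also have "expectation (\<lambda>\<omega>. indicator {..a} (B s \<omega>) * (m (B s \<omega>) * (a - B s \<omega>))) =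
        expectation (\<lambda>\<omega>. m (B s \<omega>) * (a - B s \<omega>))"
      using a by (intro Bochner_Integration.integral_cong) (auto simp: indicator_def m_def)
    \<comment> \<open>Symmetry moves the main term to positive values of \<open>B s\<close>, where
      it can be compared pointwise with the reflected term.\<close>
    also have "\<dots> = expectation (\<lambda>\<omega>. m (- B s \<omega>) * (a - (- B s \<omega>)))"
      using s by (intro expectation_normal_symmetric[OF D, of "\<lambda>x. m x * (a - x)", symmetric]) auto
    also have "\<dots> - expectation (\<lambda>\<omega>. indicator {a<..} (B s \<omega>) * (m (2 * a - B s \<omega>) * (a - (2 * a - B s \<omega>)))) =
        expectation (\<lambda>\<omega>. m (- B s \<omega>) * (a - (- B s \<omega>)) - indicator {a<..} (B s \<omega>) * (m (2 * a - B s \<omega>) * (a - (2 * a - B s \<omega>))))"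
    proof (rule Bochner_Integration.integral_diff[symmetric])
      show "integrable M (\<lambda>\<omega>. m (- B s \<omega>) * (a - (- B s \<omega>)))"
        using mY_le[of "- _"]
        by (intro iBh[of "\<lambda>x. m (- x) * (a - (- x))" 1 a 0]) auto
      show "integrable M (\<lambda>\<omega>. indicator {a<..} (B s \<omega>) * (m (2 * a - B s \<omega>) * (a - (2 * a - B s \<omega>))))"
        using m2Y_le
        by (intro iBh[of "\<lambda>x. indicator {a<..} x * (m (2 * a - x) * (a - (2 * a - x)))" 1 0 0])
           (auto simp: indicator_def)
    qed
    also have "\<dots> \<le> expectation (\<lambda>\<omega>. 4 * a * \<bar>B s \<omega>\<bar>)"
    proof (rule integral_mono')
      show "integrable M (\<lambda>\<omega>. 4 * a * \<bar>B s \<omega>\<bar>)" using iB by simp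
      \<comment> \<open>Each quadratic term alone would give order \<open>s\<close>, which is too
        large for small \<open>a\<close>. For \<open>x > 2 * a\<close> the reflected term cancels
        the square, leaving \<open>4 * a * x - 2 * a * a\<close>; for smaller positive
        \<open>x\<close> the factor \<open>a + x\<close> is at most \<open>3 * a\<close>. The factor
        \<open>a\<close> later cancels against the mean of the weight.\<close>
      have "m (- x) * (a - (- x)) - indicator {a<..} x * (m (2 * a - x) * (a - (2 * a - x))) \<le> 4 * a * \<bar>x\<bar>" for x
      proof -
        consider "x \<le> 0" | "0 < x" "x \<le> 2 * a" | "2 * a < x" by linarith
        then show ?thesis
        proof cases
          case 2
          then have "x * (a + x) \<le> x * (3 * a)" by (intro mult_left_mono) auto
          then show ?thesis using 2 a by (auto simp: m_def algebra_simps)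
        next
          case 3
          have "x * (a + x) - (x - 2 * a) * (x - a) \<le> 4 * a * x"
            by (simp add: algebra_simps)
          then show ?thesis using 3 a by (auto simp: m_def)
        qed (use a in \<open>auto simp: m_def indicator_def mult_nonneg_nonpos\<close>)
      qed
      then show "\<And>\<omega>. \<omega> \<in> space M \<Longrightarrow> m (- B s \<omega>) * (a - (- B s \<omega>)) - indicator {a<..} (B s \<omega>) * (m (2 * a - B s \<omega>) * (a - (2 * a - B s \<omega>))) \<le> 4 * a * \<bar>B s \<omega>\<bar>" .
    qed (use a in auto)
    also have "\<dots> = 4 * a * expectation (\<lambda>\<omega>. \<bar>B s \<omega>\<bar>)" by simp
    also have "\<dots> \<le> 4 * a * sqrt s" using eabs a by (intro mult_left_mono) auto
    finally have EmY: "expectation (\<lambda>\<omega>. indicator A \<omega> * (m (B s \<omega>) * (a - B s \<omega>))) \<le> 4 * a * sqrt s" .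

    let ?p = "\<lambda>\<omega>. indicator A \<omega> * (a - B s \<omega>)" and ?q = "\<lambda>\<omega>. indicator A \<omega> * u (a - B s \<omega>)"
    \<comment> \<open>A low value of \<open>B s\<close> makes both \<open>m\<close> and the ratio of
      the weights \<open>?p\<close> and \<open>?q\<close> large, so the two are positively
      associated and replacing \<open>?q\<close> by \<open>?p\<close> can only increase the weighted
      mean of \<open>m\<close>.\<close>
    have "expectation ?p * expectation (\<lambda>\<omega>. m (B s \<omega>) * ?q \<omega>) \<le> expectation (\<lambda>\<omega>. m (B s \<omega>) * ?p \<omega>) * expectation ?q"
    proof (rule chebyshev_integral_ineq)
      show "integrable M ?p" using iB by (intro iA) auto
      show "integrable M ?q" by (rule iAu)
      show "integrable M (\<lambda>\<omega>. m (B s \<omega>) * ?p \<omega>)"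
        using iA[OF iBh[OF _ mY_le]] by (simp add: ac_simps)
      have "integrable M (\<lambda>\<omega>. m (B s \<omega>) * u (a - B s \<omega>))"
        using order_trans[OF u_abs m_le] by (intro iBh[of "\<lambda>x. m x * u (a - x)" 0 1 0]) auto
      from iA[OF this] show "integrable M (\<lambda>\<omega>. m (B s \<omega>) * ?q \<omega>)" by (simp add: ac_simps)
      fix x y
      have le: "0 \<le> (m c - m b) * ((a - c) * u (a - b) - (a - b) * u (a - c))" if "b \<le> a" "c \<le> a" for b c
      proof (cases "b \<le> c")
        case True
        have "m c - m b \<le> 0" using True by (auto simp: m_def)
        moreover have "(a - c) * u (a - b) \<le> (a - b) * u (a - c)" using u_scale[of "a - c" "a - b"] True that by auto
        ultimately show ?thesis by (intro mult_nonpos_nonpos) auto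
      next
        case False
        have "m c - m b \<ge> 0" using False by (auto simp: m_def)
        moreover have "(a - c) * u (a - b) \<ge> (a - b) * u (a - c)" using u_scale[of "a - b" "a - c"] False that by auto
        ultimately show ?thesis by (intro mult_nonneg_nonneg) auto
      qed
      show "0 \<le> (m (B s y) - m (B s x)) * (?p y * ?q x - ?p x * ?q y)"
        using le[of "B s x" "B s y"] A_le[of x] A_le[of y] by (auto simp: indicator_def)
    qed
    also have "\<dots> \<le> 4 * a * sqrt s * prob (stay T a)"
      unfolding PT using EmY by (intro mult_right_mono) (auto simp: ac_simps)
    finally have "a * expectation (\<lambda>\<omega>. m (B s \<omega>) * ?q \<omega>) \<le> a * (4 * sqrt s * prob (stay T a))"
      unfolding EY by (simp add: ac_simps)
    then have "expectation (\<lambda>\<omega>. m (B s \<omega>) * ?q \<omega>) \<le> 4 * sqrt s * prob (stay T a)"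
      using a by simp
    then show ?thesis using markov[OF m_meas iBh[OF _ m_le]] by (simp add: ac_simps)
  qed

  define p where "p x = max 0 x" for x :: real
  have p_meas [measurable]: "p \<in> borel_measurable borel" unfolding p_def by simp
  have p_le: "\<bar>p x\<bar> \<le> 0 * x\<^sup>2 + 1 * \<bar>x\<bar> + 0" for x by (simp add: p_def)
  have pos: "expectation (\<lambda>\<omega>. indicator (stay T a) \<omega> * p (B s \<omega>)) \<le> 2 * sqrt s * prob (stay T a)"
  proof -
    have ip: "integrable M (\<lambda>\<omega>. p (B s \<omega>))" by (rule iBh[OF _ p_le]) simp
    have PA: "0 < prob A" unfolding A_def using s a by (intro prob_stay_pos) auto
    have EpA: "expectation (\<lambda>\<omega>. indicator A \<omega> * p (B s \<omega>)) \<le> 2 * sqrt s * prob A"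
    \<comment> \<open>If the level is low, \<open>B s \<le> a\<close> on \<open>A\<close> already
      gives the bound. If it is high, \<open>A\<close> has probability at least \<open>3/4\<close>,
      so conditioning on it costs less than a factor \<open>2\<close>.\<close>
    proof (cases "a \<le> 2 * sqrt s")
      case True
      have "expectation (\<lambda>\<omega>. indicator A \<omega> * p (B s \<omega>)) \<le> expectation (\<lambda>\<omega>. indicator A \<omega> * (2 * sqrt s))"
        using A_le True a s by (intro integral_mono iA ip) (auto simp: indicator_def p_def intro: order_trans)
      then show ?thesis by (simp add: ac_simps)
    next
      case False
      \<comment> \<open>Chebyshev's inequality for \<open>\<bar>B s\<bar>\<close>, with
        \<open>s\<close> at most a quarter of the square of \<open>a\<close>.\<close>
      have "3 / 4 \<le> expectation (\<lambda>\<omega>. 1 - (B s \<omega>)\<^sup>2 / a\<^sup>2)"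
      proof -
        have "(2 * sqrt s)\<^sup>2 \<le> a\<^sup>2" using False s by (intro power_mono) auto
        then have "s / a\<^sup>2 \<le> 1 / 4" using a s by (simp add: field_simps)
        then show ?thesis using iB2 by (simp add: prob_space eB2)
      qed
      also have "\<dots> \<le> expectation (\<lambda>\<omega>. indicator {-a..a} (B s \<omega>))"
      proof (rule integral_mono)
        show "integrable M (\<lambda>\<omega>. indicat_real {-a..a} (B s \<omega>))"
          by (intro integrable_const_bound[where B = 1]) (auto simp: indicator_def)
        fix \<omega>
        have "a\<^sup>2 \<le> x\<^sup>2" if "x \<notin> {-a..a}" for x
          using that a by (intro abs_le_square_iff[THEN iffD1]) auto
        then have "1 - x\<^sup>2 / a\<^sup>2 \<le> indicator {-a..a} x" for x
          using a by (auto simp: indicator_def field_simps)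
        then show "1 - (B s \<omega>)\<^sup>2 / a\<^sup>2 \<le> indicator {-a..a} (B s \<omega>)" .
      qed (use iB2 in auto)
      also have "\<dots> = prob A" unfolding A_def using s a by (intro prob_stay_eq(2)[symmetric]) auto
      finally have PA34: "3 / 4 \<le> prob A" .
      have "expectation (\<lambda>\<omega>. indicator A \<omega> * p (B s \<omega>)) \<le> expectation (\<lambda>\<omega>. \<bar>B s \<omega>\<bar>)"
        using iB by (intro integral_mono iA ip) (auto simp: indicator_def p_def)
      also have "\<dots> \<le> sqrt s * 1" using eabs by simp
      also have "\<dots> \<le> sqrt s * (2 * prob A)" using PA34 s by (intro mult_left_mono) auto
      finally show ?thesis by (simp add: ac_simps)
    qed
    let ?p = "\<lambda>\<omega>. indicator A \<omega> * u (a - B s \<omega>)" and ?q = "\<lambda>\<omega>. indicat_real A \<omega>"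
    \<comment> \<open>The sign makes \<open>?g\<close> decrease in \<open>B s\<close>, as the weight
      \<open>u (a - B s)\<close> does.\<close>
    let ?g = "\<lambda>\<omega>. - p (B s \<omega>)"
    have iApu: "integrable M (\<lambda>\<omega>. p (B s \<omega>) * u (a - B s \<omega>))"
      using order_trans[OF u_abs p_le] by (intro iBh[of "\<lambda>x. p x * u (a - x)" 0 1 0]) auto
    have "expectation ?p * expectation (\<lambda>\<omega>. ?g \<omega> * ?q \<omega>) \<le> expectation (\<lambda>\<omega>. ?g \<omega> * ?p \<omega>) * expectation ?q"
    proof (rule chebyshev_integral_ineq)
      show "integrable M ?p" by (rule iAu)
      show "integrable M ?q"
        by (intro integrable_const_bound[where B = 1]) (auto simp: indicator_def)
      show "integrable M (\<lambda>\<omega>. ?g \<omega> * ?p \<omega>)" using iA[OF iApu] by (simp add: ac_simps)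
      show "integrable M (\<lambda>\<omega>. ?g \<omega> * ?q \<omega>)" using iA[OF ip] by (simp add: ac_simps)
      fix x y
      have le: "0 \<le> (- p c - - p b) * (u (a - c) - u (a - b))" for b c
      proof (cases "b \<le> c")
        case True
        then show ?thesis using u_mono[of "a - c" "a - b"] by (intro mult_nonpos_nonpos) (auto simp: p_def)
      next
        case False
        then show ?thesis using u_mono[of "a - b" "a - c"] by (intro mult_nonneg_nonneg) (auto simp: p_def)
      qed
      show "0 \<le> (?g y - ?g x) * (?p y * ?q x - ?p x * ?q y)"
        using le[of "B s y" "B s x"] by (auto simp: indicator_def)
    qed
    then have "expectation (\<lambda>\<omega>. p (B s \<omega>) * ?p \<omega>) * prob A \<le>
        prob (stay T a) * expectation (\<lambda>\<omega>. indicator A \<omega> * p (B s \<omega>))"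
      unfolding PT by (simp add: ac_simps)
    also have "\<dots> \<le> prob (stay T a) * (2 * sqrt s * prob A)"
      using EpA by (intro mult_left_mono) auto
    finally have "expectation (\<lambda>\<omega>. p (B s \<omega>) * ?p \<omega>) * prob A \<le> (2 * sqrt s * prob (stay T a)) * prob A"
      by (simp add: ac_simps)
    then have "expectation (\<lambda>\<omega>. p (B s \<omega>) * ?p \<omega>) \<le> 2 * sqrt s * prob (stay T a)"
      using PA by simp
    then show ?thesis using markov[OF p_meas ip] by (simp add: ac_simps)
  qed
  have iT: "integrable M (\<lambda>\<omega>. indicator (stay T a) \<omega> * f \<omega>)" if "integrable M f" for f :: "'a \<Rightarrow> real"
    using integrable_mult_indicator[OF st(2) that] by simp
  have "expectation (\<lambda>\<omega>. indicator (stay T a) \<omega> * \<bar>B s \<omega>\<bar>) =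
    expectation (\<lambda>\<omega>. indicator (stay T a) \<omega> * p (B s \<omega>) + indicator (stay T a) \<omega> * m (B s \<omega>))"
    by (intro Bochner_Integration.integral_cong) (auto simp: p_def m_def indicator_def)
  also have "\<dots> = expectation (\<lambda>\<omega>. indicator (stay T a) \<omega> * p (B s \<omega>)) + expectation (\<lambda>\<omega>. indicator (stay T a) \<omega> * m (B s \<omega>))"
    by (intro Bochner_Integration.integral_add iT iBh[OF _ p_le] iBh[OF _ m_le]) auto
  also have "\<dots> \<le> 6 * sqrt s * prob (stay T a)"
    using neg pos by simp
  finally show ?thesis .
qed

end

subsection \<open>Discrete Cameron--Martin formula\<close>

text \<open>It suffices to compare both measures on boxes, where the indicator factorises like the
  density and the integral becomes a product of one-dimensional integrals.\<close>

lemma density_PiM: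
  fixes w :: "'i \<Rightarrow> 'a \<Rightarrow> ennreal"
  assumes I: "finite I" and M: "product_sigma_finite M"
    and N: "product_sigma_finite (\<lambda>i. density (M i) (w i))"
    and w: "\<And>i. w i \<in> borel_measurable (M i)"
  shows "density (Pi\<^sub>M I M) (\<lambda>x. \<Prod>i\<in>I. w i (x i)) = Pi\<^sub>M I (\<lambda>i. density (M i) (w i))"
proof -
  interpret M: product_sigma_finite M by fact
  interpret N: product_sigma_finite "\<lambda>i. density (M i) (w i)" by fact
  note w [measurable]
  have wm: "(\<lambda>x. \<Prod>i\<in>I. w i (x i)) \<in> borel_measurable (Pi\<^sub>M I M)"
    by (intro borel_measurable_prod_ennreal measurable_compose[OF _ w] measurable_component_singleton)
  show ?thesis
  proof (rule N.PiM_eqI[OF I])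
    show "sets (density (Pi\<^sub>M I M) (\<lambda>x. \<Prod>i\<in>I. w i (x i))) = sets (Pi\<^sub>M I (\<lambda>i. density (M i) (w i)))"
      by (simp add: sets_PiM_cong[of I I "\<lambda>i. density (M i) (w i)" M])
    fix A assume "\<And>i. i \<in> I \<Longrightarrow> A i \<in> sets (density (M i) (w i))"
    then have A: "\<And>i. i \<in> I \<Longrightarrow> A i \<in> sets (M i)" by simp
    have "emeasure (density (Pi\<^sub>M I M) (\<lambda>x. \<Prod>i\<in>I. w i (x i))) (Pi\<^sub>E I A) =
      (\<integral>\<^sup>+x. (\<Prod>i\<in>I. w i (x i)) * indicator (Pi\<^sub>E I A) x \<partial>Pi\<^sub>M I M)"
      using A I by (intro emeasure_density wm sets_PiM_I_finite) auto
    also have "\<dots> = (\<integral>\<^sup>+x. (\<Prod>i\<in>I. w i (x i) * indicator (A i) (x i)) \<partial>Pi\<^sub>M I M)"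
    proof (rule nn_integral_cong)
      fix x assume "x \<in> space (Pi\<^sub>M I M)"
      then have "indicator (Pi\<^sub>E I A) x = (\<Prod>i\<in>I. indicator (A i) (x i) :: ennreal)"
        using I by (auto simp: indicator_def space_PiM PiE_iff prod_zero_iff[OF I] intro!: prod.neutral[symmetric])
      then show "(\<Prod>i\<in>I. w i (x i)) * indicator (Pi\<^sub>E I A) x = (\<Prod>i\<in>I. w i (x i) * indicator (A i) (x i))"
        by (simp add: prod.distrib)
    qed
    also have "\<dots> = (\<Prod>i\<in>I. \<integral>\<^sup>+x. w i x * indicator (A i) x \<partial>M i)"
      using A by (intro M.product_nn_integral_prod I) auto
    also have "\<dots> = (\<Prod>i\<in>I. emeasure (density (M i) (w i)) (A i))"
      using A by (intro prod.cong refl emeasure_density[symmetric]) auto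
    finally show "emeasure (density (Pi\<^sub>M I M) (\<lambda>x. \<Prod>i\<in>I. w i (x i))) (Pi\<^sub>E I A) =
      (\<Prod>i\<in>I. emeasure (density (M i) (w i)) (A i))" .
  qed
qed

text \<open>Completing the square: the exponential is the likelihood ratio between the Gaussian laws
  of variance \<open>h\<close> with means \<open>- m * h\<close> and \<open>0\<close>.\<close>

lemma normal_density_shift:
  assumes "0 < h"
  shows "normal_density 0 (sqrt h) x * exp (- m * x - m\<^sup>2 * h / 2) = normal_density (- m * h) (sqrt h) x"
proof -
  have "- x\<^sup>2 / (2 * h) + (- m * x - m\<^sup>2 * h / 2) = - (x - - m * h)\<^sup>2 / (2 * h)"
    using assms by (simp add: field_simps power2_eq_square)
  then show ?thesis using assms by (simp add: normal_density_def exp_add[symmetric])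
qed

text \<open>Jensen's inequality for the law conditioned on \<open>A\<close>, proved by integrating
  over \<open>A\<close> the tangent to \<open>exp\<close> at the conditional mean \<open>c\<close>.
  No conditional measure has to be formed.\<close>

lemma (in prob_space) jensen_exp_event:
  assumes A: "A \<in> events" "0 < prob A"
    and int: "integrable M (\<lambda>\<omega>. indicator A \<omega> * Z \<omega>)" "integrable M (\<lambda>\<omega>. indicator A \<omega> * exp (Z \<omega>))"
  shows "prob A * exp (expectation (\<lambda>\<omega>. indicator A \<omega> * Z \<omega>) / prob A) \<le> expectation (\<lambda>\<omega>. indicator A \<omega> * exp (Z \<omega>))"
proof -
  define c where "c = expectation (\<lambda>\<omega>. indicator A \<omega> * Z \<omega>) / prob A"
  have iA: "integrable M (\<lambda>\<omega>. indicat_real A \<omega>)"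
    using A by (intro integrable_const_bound[where B = 1]) (auto simp: indicator_def)
  have "prob A * exp c = exp c * (1 - c) * prob A + exp c * expectation (\<lambda>\<omega>. indicator A \<omega> * Z \<omega>)"
    using A by (simp add: c_def field_simps)
  also have "\<dots> = expectation (\<lambda>\<omega>. exp c * (1 - c) * indicator A \<omega> + exp c * (indicator A \<omega> * Z \<omega>))"
    using A int iA by simp
  also have "\<dots> \<le> expectation (\<lambda>\<omega>. indicator A \<omega> * exp (Z \<omega>))"
  proof (rule integral_mono)
    fix \<omega>
    have "exp c * (1 + (Z \<omega> - c)) \<le> exp c * exp (Z \<omega> - c)"
      by (intro mult_left_mono exp_ge_add_one_self) auto
    then show "exp c * (1 - c) * indicator A \<omega> + exp c * (indicator A \<omega> * Z \<omega>) \<le> indicator A \<omega> * exp (Z \<omega>)"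
      by (auto simp: indicator_def exp_add[symmetric] algebra_simps)
  qed (use int iA in auto)
  finally show ?thesis by (simp add: c_def)
qed

text \<open>Trades increments of the path for its values, for which a moment bound is available, at
  the price of differences of the slopes \<open>m\<close>.\<close>

lemma sum_mult_diff_by_parts:
  fixes m b :: "nat \<Rightarrow> real"
  assumes "b 0 = 0"
  shows "(\<Sum>i<n. m i * (b (Suc i) - b i)) = m n * b n - (\<Sum>i<n. (m (Suc i) - m i) * b (Suc i))"
  by (induction n) (auto simp: assms algebra_simps)

context standard_brownian_motion begin

text \<open>Staying below the shifted level is the unshifted event for the increments with the drift
  removed, whose joint law has a product density with respect to the original one. The nonnegative
  integral makes no integrability demand on \<open>exp Z\<close>.\<close>

lemma cameron_martin_grid:
  fixes m :: "nat \<Rightarrow> real" and a :: real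
  assumes T: "0 < T" and n: "0 < n"
  defines "b \<equiv> \<lambda>k. B (real k * T / real n)"
  defines "G \<equiv> {\<omega> \<in> space M. \<forall>k\<le>n. b k \<omega> \<le> a}"
  defines "Z \<equiv> \<lambda>\<omega>. - (\<Sum>i<n. m i * (b (Suc i) \<omega> - b i \<omega>)) - T / real n / 2 * (\<Sum>i<n. (m i)\<^sup>2)"
  shows "emeasure M {\<omega> \<in> space M. \<forall>k\<le>n. b k \<omega> \<le> a + (\<Sum>i<k. m i * (T / real n))} =
    (\<integral>\<^sup>+\<omega>. ennreal (indicator G \<omega> * exp (Z \<omega>)) \<partial>M)"
proof -
  define h where "h = T / real n"
  have h: "0 < h" using T n by (simp add: h_def)
  define X where "X i \<omega> = B (real (Suc i) * T / real n) \<omega> - B (real i * T / real n) \<omega>" for i \<omega>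
  note inc = grid_increments[OF T n, folded X_def]
  have X [measurable]: "random_variable borel (X i)" for i
    using distributed_measurable[OF inc(2)] by simp
  define P where "P = (\<Pi>\<^sub>M i\<in>{..<n}. (borel :: real measure))"
  define S where "S = {v \<in> space P. \<forall>k\<in>{..n}. (\<Sum>i<k. v i) \<le> a}"
  have [measurable]: "(\<lambda>v. \<Sum>i<k. v i) \<in> borel_measurable P" if "k \<in> {..n}" for k
    unfolding P_def using that by (intro borel_measurable_sum measurable_component_singleton) auto
  have S: "S \<in> sets P" unfolding S_def by measurable
  define V where "V = (\<lambda>\<omega>. \<lambda>i\<in>{..<n}. X i \<omega>)"
  define W where "W = (\<lambda>\<omega>. \<lambda>i\<in>{..<n}. X i \<omega> - m i * h)"
  have V: "V \<in> measurable M P" and W: "W \<in> measurable M P"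
    unfolding V_def W_def P_def by (intro measurable_restrict; simp)+
  define N where "N = density lborel (normal_density 0 (sqrt h))"
  define w where "w i x = ennreal (exp (- m i * x - (m i)\<^sup>2 * h / 2))" for i x
  have w [measurable]: "w i \<in> borel_measurable borel" for i
    unfolding w_def by measurable
  have bl: "distr M borel Z = distr M lborel Z" for Z :: "'a \<Rightarrow> real"
    by (rule distr_cong) auto
  have dX: "distr M borel (X i) = N" for i
    unfolding bl N_def h_def by (rule distributed_distr_eq_density[OF inc(2)])
  have "distributed M lborel (\<lambda>\<omega>. - m i * h + 1 * X i \<omega>) (normal_density (- m i * h + 1 * 0) (\<bar>1\<bar> * sqrt h))" for i
    using inc(2)[of i] h by (intro normal_density_affine) (auto simp: h_def)
  then have "distributed M lborel (\<lambda>\<omega>. X i \<omega> - m i * h) (normal_density (- m i * h) (sqrt h))" for i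
    by (simp add: algebra_simps)
  then have "distr M borel (\<lambda>\<omega>. X i \<omega> - m i * h) = density lborel (normal_density (- m i * h) (sqrt h))" for i
    unfolding bl by (rule distributed_distr_eq_density)
  also have "density lborel (normal_density (- m i * h) (sqrt h)) = density N (w i)" for i
  proof -
    have "ennreal (normal_density 0 (sqrt h) x) * w i x = ennreal (normal_density (- m i * h) (sqrt h) x)" for x
      unfolding w_def normal_density_shift[OF h, symmetric] by (rule ennreal_mult'[symmetric]) simp
    then show ?thesis unfolding N_def by (subst density_density_eq) simp_all
  qed
  finally have dW: "distr M borel (\<lambda>\<omega>. X i \<omega> - m i * h) = density N (w i)" for i .
  have pN: "prob_space N" unfolding N_def using h by (intro prob_space_normal_density) auto
  have pNw: "prob_space (density N (w i))" for i
    unfolding dW[symmetric] by (intro prob_space_distr) simp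
  have psf: "product_sigma_finite (\<lambda>_. N)" "product_sigma_finite (\<lambda>i. density N (w i))"
    using pN pNw by (auto simp: product_sigma_finite_def intro: prob_space_imp_sigma_finite)
  have lawV: "distr M P V = (\<Pi>\<^sub>M i\<in>{..<n}. N)"
    using inc(1) n unfolding P_def V_def
    by (subst (asm) indep_vars_iff_distr_eq_PiM') (auto simp: dX)
  have "indep_vars (\<lambda>_. borel) (\<lambda>i \<omega>. X i \<omega> - m i * h) {..<n}"
    by (rule indep_vars_compose2[OF inc(1)]) simp
  then have "distr M P W = (\<Pi>\<^sub>M i\<in>{..<n}. density N (w i))"
    using n unfolding P_def W_def
    by (subst (asm) indep_vars_iff_distr_eq_PiM') (auto simp: dW)
  also have "\<dots> = density (\<Pi>\<^sub>M i\<in>{..<n}. N) (\<lambda>x. \<Prod>i<n. w i (x i))"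
    by (rule density_PiM[symmetric]) (use psf in \<open>auto simp: N_def\<close>)
  finally have lawW: "distr M P W = density (distr M P V) (\<lambda>x. \<Prod>i<n. w i (x i))"
    by (simp add: lawV)
  have prodw [measurable]: "(\<lambda>x. \<Prod>i<n. w i (x i)) \<in> borel_measurable P"
    unfolding P_def by (intro borel_measurable_prod_ennreal measurable_compose[OF _ w] measurable_component_singleton)
  have sumV: "(\<Sum>i<k. V \<omega> i) = b k \<omega>" if "k \<le> n" "\<omega> \<in> space M" for k \<omega>
  proof -
    have "(\<Sum>i<k. V \<omega> i) = (\<Sum>i<k. X i \<omega>)" using that by (intro sum.cong) (auto simp: V_def)
    then show ?thesis using inc(3) that by (simp add: b_def)
  qed
  have sumW: "(\<Sum>i<k. W \<omega> i) = b k \<omega> - (\<Sum>i<k. m i * h)" if "k \<le> n" "\<omega> \<in> space M" for k \<omega>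
  proof -
    have "(\<Sum>i<k. W \<omega> i) = (\<Sum>i<k. X i \<omega> - m i * h)" using that by (intro sum.cong) (auto simp: W_def)
    then show ?thesis using inc(3) that by (simp add: b_def sum_subtractf)
  qed
  have VG: "V \<omega> \<in> S \<longleftrightarrow> \<omega> \<in> G" if "\<omega> \<in> space M" for \<omega>
    using that sumV measurable_space[OF V] by (auto simp: S_def G_def)
  have "{\<omega> \<in> space M. \<forall>k\<le>n. b k \<omega> \<le> a + (\<Sum>i<k. m i * (T / real n))} = W -` S \<inter> space M"
    unfolding h_def[symmetric] using sumW measurable_space[OF W]
    by (auto simp: S_def diff_le_eq)
  then have "emeasure M {\<omega> \<in> space M. \<forall>k\<le>n. b k \<omega> \<le> a + (\<Sum>i<k. m i * (T / real n))} =
    emeasure (distr M P W) S"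
    using W S by (simp add: emeasure_distr)
  also have "\<dots> = (\<integral>\<^sup>+x. (\<Prod>i<n. w i (x i)) * indicator S x \<partial>distr M P V)"
    unfolding lawW using S by (intro emeasure_density) auto
  also have "\<dots> = (\<integral>\<^sup>+\<omega>. (\<Prod>i<n. w i (V \<omega> i)) * indicator S (V \<omega>) \<partial>M)"
    using V S by (intro nn_integral_distr) auto
  also have "\<dots> = (\<integral>\<^sup>+\<omega>. ennreal (indicator G \<omega> * exp (Z \<omega>)) \<partial>M)"
  proof (rule nn_integral_cong)
    fix \<omega> assume \<omega>: "\<omega> \<in> space M"
    have "(\<Prod>i<n. w i (V \<omega> i)) = (\<Prod>i<n. ennreal (exp (- m i * X i \<omega> - (m i)\<^sup>2 * h / 2)))"
      by (intro prod.cong) (auto simp: w_def V_def)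
    also have "\<dots> = ennreal (exp (\<Sum>i<n. - m i * X i \<omega> - (m i)\<^sup>2 * h / 2))"
      by (simp add: prod_ennreal exp_sum)
    also have "(\<Sum>i<n. - m i * X i \<omega> - (m i)\<^sup>2 * h / 2) = Z \<omega>"
      by (simp add: Z_def X_def b_def h_def sum_subtractf sum_negf sum_distrib_left sum_distrib_right sum_divide_distrib ac_simps)
    finally show "(\<Prod>i<n. w i (V \<omega> i)) * indicator S (V \<omega>) = ennreal (indicator G \<omega> * exp (Z \<omega>))"
      using VG[OF \<omega>] by (simp add: indicator_def)
  qed
  finally show ?thesis .
qed

text \<open>Jensen's inequality turns the discrete density into a bound on the conditional mean of
  the linear term \<open>Y\<close>. Summation by parts leaves values of the path only, and each
  costs \<open>6 * sqrt\<close> of its time by \<open>stay_moment\<close>.\<close>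

lemma grid_lower_bound:
  fixes m :: "nat \<Rightarrow> real"
  assumes T: "0 < T" and n: "0 < n" and a: "0 < a"
  shows "prob {\<omega> \<in> space M. \<forall>k\<le>n. B (real k * T / real n) \<omega> \<le> a + (\<Sum>i<k. m i * (T / real n))} \<ge>
    prob (stay T a) * exp (- (T / real n / 2 * (\<Sum>i<n. (m i)\<^sup>2))
      - 6 * (\<bar>m n\<bar> * sqrt T + (\<Sum>i<n. \<bar>m (Suc i) - m i\<bar> * sqrt (real (Suc i) * T / real n))))"
proof -
  define b where "b = (\<lambda>k. B (real k * T / real n))"
  define G where "G = {\<omega> \<in> space M. \<forall>k\<le>n. b k \<omega> \<le> a}"
  define Y where "Y \<omega> = (\<Sum>i<n. m i * (b (Suc i) \<omega> - b i \<omega>))" for \<omega>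
  define Q where "Q = T / real n / 2 * (\<Sum>i<n. (m i)\<^sup>2)"
  let ?E = "{\<omega> \<in> space M. \<forall>k\<le>n. b k \<omega> \<le> a + (\<Sum>i<k. m i * (T / real n))}"
  define A where "A = stay T a"
  have A [measurable]: "A \<in> events" using T by (auto simp: A_def intro: stay_events)
  have PA: "0 < prob A" unfolding A_def by (rule prob_stay_pos[OF T a])
  have b_meas [measurable]: "random_variable borel (b k)" for k
    unfolding b_def using T by (intro random_variable) auto
  have "G = {\<omega> \<in> space M. \<forall>k\<in>{..n}. b k \<omega> \<le> a}" by (auto simp: G_def)
  then have [measurable]: "G \<in> events" by simp
  have Y_meas [measurable]: "random_variable borel Y" unfolding Y_def by measurable
  have em: "emeasure M ?E = (\<integral>\<^sup>+\<omega>. ennreal (indicator G \<omega> * exp (- Y \<omega> - Q)) \<partial>M)"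
    using cameron_martin_grid[OF T n, of a m] by (simp add: b_def G_def Y_def Q_def)
  \<comment> \<open>The integral is a probability by \<open>em\<close>, so integrability of the
    exponential comes for free.\<close>
  have intG: "integrable M (\<lambda>\<omega>. indicator G \<omega> * exp (- Y \<omega> - Q))"
    by (rule integrableI_nonneg) (auto simp: em[symmetric] emeasure_eq_measure)
  have probE: "prob ?E = expectation (\<lambda>\<omega>. indicator G \<omega> * exp (- Y \<omega> - Q))"
    unfolding measure_def em by (rule integral_eq_nn_integral[symmetric]) auto
  \<comment> \<open>The exponential is nonnegative, so passing from \<open>G\<close> to the smaller
    event \<open>A\<close>, where \<open>stay_moment\<close> applies, loses only in the permitted
    direction.\<close>
  have AG: "indicator A \<omega> \<le> indicat_real G \<omega>" for \<omega>
    using grid_point_mem[of T _ n] T by (auto simp: indicator_def A_def G_def stay_def b_def)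
  have intA: "integrable M (\<lambda>\<omega>. indicator A \<omega> * exp (- Y \<omega> - Q))"
    by (rule Bochner_Integration.integrable_bound[OF intG])
       (auto intro!: AE_I2 mult_right_mono AG simp: abs_mult)
  have ib: "integrable M (b k)" for k
  proof (cases "real k * T / real n = 0")
    case True
    then have "integrable M (b k) \<longleftrightarrow> integrable M (\<lambda>_. 0 :: real)"
      by (intro Bochner_Integration.integrable_cong) (auto simp: b_def start_zero)
    then show ?thesis by simp
  next
    case False
    then have "0 < real k * T / real n" using T n by (auto intro!: divide_pos_pos mult_pos_pos)
    then show ?thesis unfolding b_def
      using normal_moments(1)[OF distributed_B] by simp
  qed
  have iY: "integrable M Y" unfolding Y_def using ib by simp
  have iA: "integrable M (\<lambda>\<omega>. indicator A \<omega> * f \<omega>)" if "integrable M f" for f :: "'a \<Rightarrow> real"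
    using integrable_mult_indicator[OF A that] by simp
  have moment: "expectation (\<lambda>\<omega>. indicator A \<omega> * \<bar>b k \<omega>\<bar>) \<le> 6 * sqrt (real k * T / real n) * prob A" if "k \<le> n" for k
    unfolding A_def b_def using grid_point_mem[OF _ that, of T] T by (intro stay_moment[OF a]) auto
  define R where "R = \<bar>m n\<bar> * sqrt T + (\<Sum>i<n. \<bar>m (Suc i) - m i\<bar> * sqrt (real (Suc i) * T / real n))"
  have "expectation (\<lambda>\<omega>. indicator A \<omega> * Y \<omega>) \<le>
      expectation (\<lambda>\<omega>. \<bar>m n\<bar> * (indicator A \<omega> * \<bar>b n \<omega>\<bar>) + (\<Sum>i<n. \<bar>m (Suc i) - m i\<bar> * (indicator A \<omega> * \<bar>b (Suc i) \<omega>\<bar>)))"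
  proof (rule integral_mono[OF iA[OF iY]])
    show "integrable M (\<lambda>\<omega>. \<bar>m n\<bar> * (indicator A \<omega> * \<bar>b n \<omega>\<bar>) + (\<Sum>i<n. \<bar>m (Suc i) - m i\<bar> * (indicator A \<omega> * \<bar>b (Suc i) \<omega>\<bar>)))"
      using iA[OF integrable_abs[OF ib]] by auto
    fix \<omega> assume \<omega>: "\<omega> \<in> space M"
    have "Y \<omega> = m n * b n \<omega> - (\<Sum>i<n. (m (Suc i) - m i) * b (Suc i) \<omega>)"
      unfolding Y_def using \<omega> by (intro sum_mult_diff_by_parts) (simp add: b_def start_zero)
    also have "\<dots> \<le> \<bar>m n * b n \<omega>\<bar> + (\<Sum>i<n. \<bar>(m (Suc i) - m i) * b (Suc i) \<omega>\<bar>)"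
      using sum_abs[of "\<lambda>i. (m (Suc i) - m i) * b (Suc i) \<omega>" "{..<n}"] by linarith
    finally show "indicator A \<omega> * Y \<omega> \<le> \<bar>m n\<bar> * (indicator A \<omega> * \<bar>b n \<omega>\<bar>) + (\<Sum>i<n. \<bar>m (Suc i) - m i\<bar> * (indicator A \<omega> * \<bar>b (Suc i) \<omega>\<bar>))"
      by (auto simp: indicator_def abs_mult)
  qed
  also have "\<dots> = \<bar>m n\<bar> * expectation (\<lambda>\<omega>. indicator A \<omega> * \<bar>b n \<omega>\<bar>) +
     (\<Sum>i<n. \<bar>m (Suc i) - m i\<bar> * expectation (\<lambda>\<omega>. indicator A \<omega> * \<bar>b (Suc i) \<omega>\<bar>))"
    using iA[OF integrable_abs[OF ib]] by (simp add: Bochner_Integration.integral_sum)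
  also have "\<dots> \<le> \<bar>m n\<bar> * (6 * sqrt (real n * T / real n) * prob A) +
     (\<Sum>i<n. \<bar>m (Suc i) - m i\<bar> * (6 * sqrt (real (Suc i) * T / real n) * prob A))"
    by (intro add_mono sum_mono mult_left_mono moment) auto
  also have "\<dots> = 6 * R * prob A"
    using n by (simp add: R_def algebra_simps sum_distrib_left sum_distrib_right)
  finally have EY: "expectation (\<lambda>\<omega>. indicator A \<omega> * Y \<omega>) \<le> 6 * R * prob A" .
  have "expectation (\<lambda>\<omega>. indicator A \<omega> * (- Y \<omega> - Q)) =
     expectation (\<lambda>\<omega>. - (indicator A \<omega> * Y \<omega>) - Q * indicator A \<omega>)"
    by (simp add: algebra_simps)
  also have "\<dots> = - expectation (\<lambda>\<omega>. indicator A \<omega> * Y \<omega>) - Q * prob A"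
    using iA[OF iY] iA[of "\<lambda>_. 1"] A by simp
  finally have EZ: "expectation (\<lambda>\<omega>. indicator A \<omega> * (- Y \<omega> - Q)) \<ge> (- Q - 6 * R) * prob A"
    using EY by (simp add: algebra_simps)
  have "prob A * exp (- Q - 6 * R) \<le> prob A * exp (expectation (\<lambda>\<omega>. indicator A \<omega> * (- Y \<omega> - Q)) / prob A)"
    using EZ PA by (simp add: pos_le_divide_eq)
  also have "\<dots> \<le> expectation (\<lambda>\<omega>. indicator A \<omega> * exp (- Y \<omega> - Q))"
    using iY by (intro jensen_exp_event A PA intA iA) auto
  also have "\<dots> \<le> expectation (\<lambda>\<omega>. indicator G \<omega> * exp (- Y \<omega> - Q))"
    by (intro integral_mono intA intG mult_right_mono AG) auto
  finally show ?thesis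
    unfolding probE[symmetric] by (simp add: A_def b_def R_def Q_def)
qed

end

subsection \<open>Smooth boundaries\<close>

text \<open>The order of the two end points is proved along with the sum, since the induction step
  needs it to join intervals.\<close>

lemma sum_integral_partition:
  fixes g :: "real \<Rightarrow> real" and x :: "nat \<Rightarrow> real"
  assumes mono: "\<And>i. i < n \<Longrightarrow> x i \<le> x (Suc i)" and g: "g integrable_on {x 0..x n}"
  shows "x 0 \<le> x n \<and> (\<Sum>i<n. integral {x i..x (Suc i)} g) = integral {x 0..x n} g"
  using assms
proof (induction n)
  case (Suc n)
  have le: "x n \<le> x (Suc n)" using Suc.prems by simp
  have "g integrable_on {x 0..x n}"
    by (rule integrable_subinterval_real[OF Suc.prems(2)]) (use le in auto)
  then have IH: "x 0 \<le> x n" "(\<Sum>i<n. integral {x i..x (Suc i)} g) = integral {x 0..x n} g"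
    using Suc.IH Suc.prems(1) by auto
  show ?case
    using Henstock_Kurzweil_Integration.integral_combine[OF IH(1) le Suc.prems(2)] IH le
    by (simp only: sum.lessThan_Suc) (auto intro: order_trans)
qed simp

lemma C2_halflineD:
  assumes C: "C2_halfline f f' f''"
  shows "continuous_on {0..} f" "continuous_on {0..} f'" "continuous_on {0..} f''"
    "0 \<le> x \<Longrightarrow> x \<le> y \<Longrightarrow> (f' has_integral f y - f x) {x..y}"
    "0 \<le> x \<Longrightarrow> x \<le> y \<Longrightarrow> (f'' has_integral f' y - f' x) {x..y}"
proof -
  note C' = C[unfolded C2_halfline_def]
  show "continuous_on {0..} f" "continuous_on {0..} f'"
    using C' by (auto simp: continuous_on_eq_continuous_within intro: DERIV_continuous)
  show "continuous_on {0..} f''" using C' by simp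
  show "(f' has_integral f y - f x) {x..y}" if "0 \<le> x" "x \<le> y"
  proof (rule fundamental_theorem_of_calculus[OF that(2)])
    fix z assume "z \<in> {x..y}"
    then have "(f has_real_derivative f' z) (at z within {x..y})"
      using C' that by (intro DERIV_subset[of f "f' z" z "{0..}" "{x..y}"]) auto
    then show "(f has_vector_derivative f' z) (at z within {x..y})"
      by (simp add: has_real_derivative_iff_has_vector_derivative)
  qed
  show "(f'' has_integral f' y - f' x) {x..y}" if "0 \<le> x" "x \<le> y"
  proof (rule fundamental_theorem_of_calculus[OF that(2)])
    fix z assume "z \<in> {x..y}"
    then have "(f' has_real_derivative f'' z) (at z within {x..y})"
      using C' that by (intro DERIV_subset[of f' "f'' z" z "{0..}" "{x..y}"]) auto
    then show "(f' has_vector_derivative f'' z) (at z within {x..y})"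
      by (simp add: has_real_derivative_iff_has_vector_derivative)
  qed
qed

text \<open>The mean slopes of \<open>f\<close> over the grid intervals are values of \<open>f'\<close> at increasing points
  \<open>\<xi> 0 \<le> \<xi> 1 \<le> \<dots> \<le> \<xi> n = T\<close>; hence their total variation is controlled by integrals of \<open>\<bar>f''\<bar>\<close> over
  adjacent intervals.\<close>

lemma C2_grid_slopes:
  assumes C: "C2_halfline f f' f''" and T: "0 < T" and n: "0 < n"
  obtains m :: "nat \<Rightarrow> real" where
    "\<And>k. k \<le> n \<Longrightarrow> f (real k * T / real n) = f 0 + (\<Sum>i<k. m i * (T / real n))"
    "m n = f' T"
    "T / real n * (\<Sum>i<n. (m i)\<^sup>2) \<le> integral {0..T} (\<lambda>s. (f' s)\<^sup>2)"
    "(\<Sum>i<n. \<bar>m (Suc i) - m i\<bar> * sqrt (real (Suc i) * T / real n)) \<le>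
       integral {0..T} (\<lambda>s. \<bar>f'' s\<bar> * sqrt s) + sqrt (T / real n) * integral {0..T} (\<lambda>s. \<bar>f'' s\<bar>)"
proof -
  define h where "h = T / real n"
  have h: "0 < h" using T n by (simp add: h_def)
  have nh: "real n * h = T" using n by (simp add: h_def)
  define t where "t i = real i * h" for i :: nat
  have t_Suc: "t (Suc i) = t i + h" for i by (simp add: t_def algebra_simps)
  have t0: "0 \<le> t i" for i using h by (simp add: t_def)
  have tn: "t n = T" by (simp add: t_def nh)
  note D = C2_halflineD[OF C]
  have cont: "continuous_on {x..y} f'" "continuous_on {x..y} f''" if "0 \<le> x" for x y
    using continuous_on_subset[OF D(2), of "{x..y}"] continuous_on_subset[OF D(3), of "{x..y}"] that by auto
  have "\<exists>\<xi>. t i < \<xi> \<and> \<xi> < t (Suc i) \<and> f (t (Suc i)) - f (t i) = h * f' \<xi>" for i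
  proof -
    have "\<exists>x\<in>{t i<..<t (Suc i)}. f (t (Suc i)) - f (t i) = f' x * (t (Suc i) - t i)"
    proof (rule mvt_simple)
      fix x assume x: "t i \<le> x" "x \<le> t (Suc i)"
      have "(f has_real_derivative f' x) (at x within {0..})"
        using C x t0[of i] by (auto simp: C2_halfline_def)
      then have "(f has_real_derivative f' x) (at x within {t i..t (Suc i)})"
        by (rule DERIV_subset) (use t0[of i] in auto)
      then show "(f has_derivative (*) (f' x)) (at x within {t i..t (Suc i)})"
        by (simp add: has_field_derivative_def)
    qed (use h in \<open>simp add: t_Suc\<close>)
    then show ?thesis by (auto simp: t_Suc mult.commute)
  qed
  then obtain \<xi>' where \<xi>': "\<And>i. t i < \<xi>' i" "\<And>i. \<xi>' i < t (Suc i)"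
      "\<And>i. f (t (Suc i)) - f (t i) = h * f' (\<xi>' i)"
    using choice[of "\<lambda>i \<xi>. t i < \<xi> \<and> \<xi> < t (Suc i) \<and> f (t (Suc i)) - f (t i) = h * f' \<xi>"] by blast
  \<comment> \<open>The extra point \<open>T\<close> at index \<open>n\<close> makes the boundary
    term of the summation by parts equal to \<open>f' T\<close>.\<close>
  define \<xi> where "\<xi> i = (if i < n then \<xi>' i else T)" for i
  define m where "m i = f' (\<xi> i)" for i
  have \<xi>_Suc: "\<xi> i \<le> \<xi> (Suc i)" if "i < n" for i
  proof (cases "Suc i < n")
    case True
    then show ?thesis using \<xi>'(2)[of i] \<xi>'(1)[of "Suc i"] that by (simp add: \<xi>_def)
  next
    case False
    then have "Suc i = n" using that by simp
    then show ?thesis using \<xi>'(2)[of i] tn that by (simp add: \<xi>_def)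
  qed
  have \<xi>_ge: "t i \<le> \<xi> i" if "i < n" for i using \<xi>'(1)[of i] that by (simp add: \<xi>_def)
  have \<xi>0: "0 \<le> \<xi> i" for i using t0[of i] \<xi>'(1)[of i] T by (auto simp: \<xi>_def)
  have \<xi>n: "\<xi> n = T" by (simp add: \<xi>_def)
  show ?thesis
  proof (rule that[of m])
    have "f (t k) = f 0 + (\<Sum>i<k. m i * h)" if "k \<le> n" for k
      using that
    proof (induction k)
      case (Suc k)
      then show ?case using \<xi>'(3)[of k] by (simp add: m_def \<xi>_def algebra_simps)
    qed (simp add: t_def)
    then show "f (real k * T / real n) = f 0 + (\<Sum>i<k. m i * (T / real n))" if "k \<le> n" for k
      using that by (simp add: t_def h_def)
    show "m n = f' T" by (simp add: m_def \<xi>n)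
    have i1: "(\<lambda>s. (f' s)\<^sup>2) integrable_on {x..y}" if "0 \<le> x" for x y
      by (intro integrable_continuous_real continuous_intros cont that)
    have "h * (m i)\<^sup>2 \<le> integral {t i..t (Suc i)} (\<lambda>s. (f' s)\<^sup>2)" if "i < n" for i
    proof -
      have "(f' has_integral h * m i) {t i..t (Suc i)}"
        using D(4)[of "t i" "t (Suc i)"] t0[of i] h \<xi>'(3)[of i] that by (simp add: t_Suc m_def \<xi>_def)
      \<comment> \<open>The mean slope satisfies the Cauchy--Schwarz bound; it follows by
        integrating the nonnegative square of \<open>f' s - m i\<close>.\<close>
      then have "((\<lambda>s. 2 * m i * f' s - (m i)\<^sup>2) has_integral 2 * m i * (h * m i) - h * (m i)\<^sup>2) {t i..t (Suc i)}"
        using h has_integral_const_real[of "(m i)\<^sup>2" "t i" "t (Suc i)"]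
        by (intro has_integral_diff has_integral_mult_right) (auto simp: t_Suc)
      moreover have "((\<lambda>s. (f' s)\<^sup>2) has_integral integral {t i..t (Suc i)} (\<lambda>s. (f' s)\<^sup>2)) {t i..t (Suc i)}"
        using i1[OF t0] by (rule integrable_integral)
      ultimately have "2 * m i * (h * m i) - h * (m i)\<^sup>2 \<le> integral {t i..t (Suc i)} (\<lambda>s. (f' s)\<^sup>2)"
      proof (rule has_integral_le)
        fix s
        have "0 \<le> (f' s - m i)\<^sup>2" by simp
        then show "2 * m i * f' s - (m i)\<^sup>2 \<le> (f' s)\<^sup>2" by (simp add: power2_diff algebra_simps)
      qed
      then show ?thesis by (simp add: power2_eq_square algebra_simps)
    qed
    then have "h * (\<Sum>i<n. (m i)\<^sup>2) \<le> (\<Sum>i<n. integral {t i..t (Suc i)} (\<lambda>s. (f' s)\<^sup>2))"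
      unfolding sum_distrib_left by (intro sum_mono) auto
    also have "\<dots> = integral {t 0..t n} (\<lambda>s. (f' s)\<^sup>2)"
      using h by (intro sum_integral_partition[THEN conjunct2] i1) (auto simp: t_Suc t0)
    finally show "T / real n * (\<Sum>i<n. (m i)\<^sup>2) \<le> integral {0..T} (\<lambda>s. (f' s)\<^sup>2)"
      by (simp add: tn h_def[symmetric]) (simp add: t_def)
    \<comment> \<open>On the interval starting at \<open>\<xi> i\<close> the next grid time exceeds
      \<open>s\<close> by at most \<open>h\<close>, hence
      \<open>sqrt (t (Suc i)) \<le> sqrt s + sqrt h\<close>. The second summand is the
      discretisation error.\<close>
    let ?g = "\<lambda>s. \<bar>f'' s\<bar> * sqrt s + sqrt h * \<bar>f'' s\<bar>"
    have i2: "?g integrable_on {x..y}" "(\<lambda>s. \<bar>f'' s\<bar>) integrable_on {x..y}"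
      "(\<lambda>s. \<bar>f'' s\<bar> * sqrt s) integrable_on {x..y}" if "0 \<le> x" for x y
      by (intro integrable_continuous_real continuous_intros cont that)+
    have "\<bar>m (Suc i) - m i\<bar> * sqrt (t (Suc i)) \<le> integral {\<xi> i..\<xi> (Suc i)} ?g" if i: "i < n" for i
    proof -
      have "m (Suc i) - m i = integral {\<xi> i..\<xi> (Suc i)} f''"
        using integral_unique[OF D(5)[OF \<xi>0 \<xi>_Suc[OF i]]] by (simp add: m_def)
      also have "norm \<dots> \<le> integral {\<xi> i..\<xi> (Suc i)} (\<lambda>s. \<bar>f'' s\<bar>)"
        by (rule integral_norm_bound_integral)
           (use i2(2)[OF \<xi>0] in \<open>auto intro!: integrable_continuous_real cont \<xi>0\<close>)
      finally have "\<bar>m (Suc i) - m i\<bar> * sqrt (t (Suc i)) \<le> integral {\<xi> i..\<xi> (Suc i)} (\<lambda>s. \<bar>f'' s\<bar>) * sqrt (t (Suc i))"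
        using t0 by (intro mult_right_mono) auto
      also have "\<dots> = integral {\<xi> i..\<xi> (Suc i)} (\<lambda>s. \<bar>f'' s\<bar> * sqrt (t (Suc i)))"
        by simp
      also have "\<dots> \<le> integral {\<xi> i..\<xi> (Suc i)} ?g"
      proof (rule integral_le)
        fix s assume "s \<in> {\<xi> i..\<xi> (Suc i)}"
        then have "t (Suc i) \<le> s + h" "0 \<le> s" using \<xi>_ge[OF i] \<xi>0[of i] by (auto simp: t_Suc)
        then have "sqrt (t (Suc i)) \<le> sqrt s + sqrt h"
          using sqrt_add_le_add_sqrt[of s h] h by (smt (verit) real_sqrt_le_mono)
        then have "\<bar>f'' s\<bar> * sqrt (t (Suc i)) \<le> \<bar>f'' s\<bar> * (sqrt s + sqrt h)"
          by (intro mult_left_mono) auto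
        then show "\<bar>f'' s\<bar> * sqrt (t (Suc i)) \<le> ?g s" by (simp add: algebra_simps)
      qed (use i2[OF \<xi>0] in \<open>auto intro!: integrable_on_mult_left\<close>)
      finally show ?thesis .
    qed
    then have "(\<Sum>i<n. \<bar>m (Suc i) - m i\<bar> * sqrt (t (Suc i))) \<le> (\<Sum>i<n. integral {\<xi> i..\<xi> (Suc i)} ?g)"
      by (intro sum_mono) auto
    also have "\<dots> = integral {\<xi> 0..\<xi> n} ?g"
      by (intro sum_integral_partition[THEN conjunct2] i2 \<xi>0) (rule \<xi>_Suc)
    also have "\<dots> \<le> integral {0..T} ?g"
      using \<xi>0 h by (intro integral_subset_le i2) (auto simp: \<xi>n)
    also have "\<dots> = integral {0..T} (\<lambda>s. \<bar>f'' s\<bar> * sqrt s) + sqrt h * integral {0..T} (\<lambda>s. \<bar>f'' s\<bar>)"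
      using i2 by (subst Henstock_Kurzweil_Integration.integral_add) (auto intro!: integrable_on_mult_right)
    finally show "(\<Sum>i<n. \<bar>m (Suc i) - m i\<bar> * sqrt (real (Suc i) * T / real n)) \<le>
       integral {0..T} (\<lambda>s. \<bar>f'' s\<bar> * sqrt s) + sqrt (T / real n) * integral {0..T} (\<lambda>s. \<bar>f'' s\<bar>)"
      by (simp add: t_def h_def)
  qed
qed

lemma LBINT_Icc_eq_integral:
  fixes g :: "real \<Rightarrow> real"
  assumes "continuous_on {a..b} g"
  shows "(LBINT s:{a..b}. g s) = integral {a..b} g"
  using assms by (intro set_borel_integral_eq_integral borel_integrable_atLeastAtMost')

context standard_brownian_motion begin

text \<open>Both 6s come from the single moment bound: one multiplies the variation of the slopes,
  the other the boundary term at \<open>T\<close>.\<close>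

lemma moving_boundary_lower_bound:
  assumes C: "C2_halfline f f' f''" and f0: "f 0 > 0" and T: "T > 0"
  shows "prob {\<omega> \<in> space M. \<forall>t\<in>{0..T}. B t \<omega> \<le> f t} \<ge>
    prob (stay T (f 0)) * exp (- (1 / 2) * (LBINT s:{0..T}. (f' s)\<^sup>2)
      - 6 * (LBINT s:{0..T}. \<bar>f'' s\<bar> * sqrt s) - 6 * sqrt T * \<bar>f' T\<bar>)"
proof -
  note D = C2_halflineD[OF C]
  have cf: "continuous_on {0..T} f" "continuous_on {0..T} f'" "continuous_on {0..T} f''"
    using D(1-3) by (auto intro: continuous_on_subset)
  define I1 where "I1 = integral {0..T} (\<lambda>s. (f' s)\<^sup>2)"
  define I2 where "I2 = integral {0..T} (\<lambda>s. \<bar>f'' s\<bar> * sqrt s)"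
  define I3 where "I3 = integral {0..T} (\<lambda>s. \<bar>f'' s\<bar>)"
  define E where "E n = {\<omega> \<in> space M. \<forall>k\<le>n. B (real k * T / real n) \<omega> \<le> f (real k * T / real n)}" for n
  define E' where "E' = {\<omega> \<in> space M. \<forall>t\<in>{0..T}. B t \<omega> \<le> f t}"
  define P where "P = prob (stay T (f 0))"
  have b_meas [measurable]: "random_variable borel (B (real k * T / real n))" for k n
    using T by (intro random_variable) auto
  have E_ev: "E n \<in> events" for n
  proof -
    have "E n = {\<omega> \<in> space M. \<forall>k\<in>{..n}. B (real k * T / real n) \<omega> \<le> f (real k * T / real n)}"
      by (auto simp: E_def)
    then show ?thesis by simp
  qed
  have E'_ev: "E' \<in> events" unfolding E'_def using cf T by (intro below_measurable) auto
  have lim: "(\<lambda>n. prob (E n)) \<longlonglongrightarrow> prob E'"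
  proof -
    have "(\<lambda>n. expectation (indicat_real (E n))) \<longlonglongrightarrow> expectation (indicat_real E')"
    proof (rule integral_dominated_convergence[where w = "\<lambda>_. 1"])
      show "AE \<omega> in M. (\<lambda>n. indicat_real (E n) \<omega>) \<longlonglongrightarrow> indicat_real E' \<omega>"
        using below_LIMSEQ[OF cf(1)] T by (intro AE_I2) (auto simp: E_def E'_def indicator_def)
    qed (use E_ev E'_ev in \<open>auto simp: indicator_def\<close>)
    then show ?thesis using E_ev E'_ev by simp
  qed
  have bound: "P * exp (- (I1 / 2) - 6 * (\<bar>f' T\<bar> * sqrt T + (I2 + sqrt (T / real n) * I3))) \<le> prob (E n)"
    if n: "0 < n" for n
  proof -
    obtain m :: "nat \<Rightarrow> real" where m:
      "\<And>k. k \<le> n \<Longrightarrow> f (real k * T / real n) = f 0 + (\<Sum>i<k. m i * (T / real n))"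
      "m n = f' T" "T / real n * (\<Sum>i<n. (m i)\<^sup>2) \<le> I1"
      "(\<Sum>i<n. \<bar>m (Suc i) - m i\<bar> * sqrt (real (Suc i) * T / real n)) \<le> I2 + sqrt (T / real n) * I3"
      by (rule C2_grid_slopes[OF C T n, folded I1_def I2_def I3_def]) (rule that)
    have "P * exp (- (I1 / 2) - 6 * (\<bar>f' T\<bar> * sqrt T + (I2 + sqrt (T / real n) * I3))) \<le>
      P * exp (- (T / real n / 2 * (\<Sum>i<n. (m i)\<^sup>2))
      - 6 * (\<bar>m n\<bar> * sqrt T + (\<Sum>i<n. \<bar>m (Suc i) - m i\<bar> * sqrt (real (Suc i) * T / real n))))"
      using m(2-4) by (intro mult_left_mono) (auto simp: P_def)
    also have "\<dots> \<le> prob {\<omega> \<in> space M. \<forall>k\<le>n. B (real k * T / real n) \<omega> \<le> f 0 + (\<Sum>i<k. m i * (T / real n))}"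
      unfolding P_def by (rule grid_lower_bound[OF T n f0])
    also have "\<dots> = prob (E n)"
      unfolding E_def using m(1) by (intro arg_cong[where f = prob]) auto
    finally show ?thesis .
  qed
  \<comment> \<open>\<open>I3\<close> is a fixed real number, so the error term
    \<open>sqrt (T / n) * I3\<close> vanishes in the limit.\<close>
  have "(\<lambda>n. sqrt (T / real n)) \<longlonglongrightarrow> sqrt 0"
    by (intro tendsto_real_sqrt lim_const_over_n)
  then have "(\<lambda>n. P * exp (- (I1 / 2) - 6 * (\<bar>f' T\<bar> * sqrt T + (I2 + sqrt (T / real n) * I3))))
      \<longlonglongrightarrow> P * exp (- (I1 / 2) - 6 * (\<bar>f' T\<bar> * sqrt T + (I2 + sqrt 0 * I3)))"
    by (intro tendsto_intros)
  then have "P * exp (- (I1 / 2) - 6 * (\<bar>f' T\<bar> * sqrt T + (I2 + sqrt 0 * I3))) \<le> prob E'"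
    by (rule tendsto_le[OF sequentially_bot lim])
       (rule eventually_mono[OF eventually_gt_at_top[of 0] bound])
  moreover have "(LBINT s:{0..T}. (f' s)\<^sup>2) = I1" "(LBINT s:{0..T}. \<bar>f'' s\<bar> * sqrt s) = I2"
    unfolding I1_def I2_def using cf by (intro LBINT_Icc_eq_integral continuous_intros; simp)+
  ultimately show ?thesis by (simp add: E'_def P_def algebra_simps)
qed

end

subsection \<open>Asymptotics\<close>

lemma real_powr_minus_three_halves:
  assumes "0 < (s::real)"
  shows "s powr - (3 / 2) = 1 / (s * sqrt s)"
proof -
  have "s powr - (3 / 2) = s powr - (1 + 1 / 2)" by simp
  also have "\<dots> = 1 / (s powr (1 + 1 / 2))" by (rule powr_minus_divide)
  also have "s powr (1 + 1 / 2) = s * sqrt s"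
    using assms by (simp only: powr_add) (simp add: powr_half_sqrt)
  finally show ?thesis .
qed

text \<open>Converts the improper integrability condition into one constant for all compact
  intervals, on which \<open>f\<close> is continuous and the gauge integral is convenient.\<close>

lemma weighted_integral_bounded:
  fixes f :: "real \<Rightarrow> real"
  assumes cont: "continuous_on {0..} f"
    and fin: "(\<integral>\<^sup>+t\<in>{1..}. ennreal (\<bar>f t\<bar> * t powr (- 3 / 2)) \<partial>lborel) < \<infinity>"
  obtains J where "0 \<le> J" "\<And>x y. 1 \<le> x \<Longrightarrow> integral {x..y} (\<lambda>s. \<bar>f s\<bar> / (s * sqrt s)) \<le> J"
proof
  let ?h = "\<lambda>s. \<bar>f s\<bar> / (s * sqrt s)"
  define K where "K = (\<integral>\<^sup>+t\<in>{1..}. ennreal (\<bar>f t\<bar> * t powr (- 3 / 2)) \<partial>lborel)"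
  show "0 \<le> enn2real K" by simp
  fix x y :: real assume x: "1 \<le> x"
  have c: "continuous_on {x..y} ?h"
    using x by (intro continuous_intros continuous_on_subset[OF cont]) auto
  have si: "set_integrable lborel {x..y} ?h" using c by (rule borel_integrable_atLeastAtMost')
  then have m: "(\<lambda>s. indicator {x..y} s * ?h s) \<in> borel_measurable lborel"
    unfolding set_integrable_def by (auto dest: borel_measurable_integrable)
  have "integral {x..y} ?h = (\<integral>s. indicator {x..y} s * ?h s \<partial>lborel)"
    unfolding LBINT_Icc_eq_integral[OF c, symmetric] by (simp add: set_lebesgue_integral_def)
  also have "\<dots> = enn2real (\<integral>\<^sup>+s. ennreal (indicator {x..y} s * ?h s) \<partial>lborel)"
    using x by (intro integral_eq_nn_integral m AE_I2) (auto simp: indicator_def)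
  also have "\<dots> \<le> enn2real K"
  proof (rule enn2real_mono)
    show "(\<integral>\<^sup>+s. ennreal (indicator {x..y} s * ?h s) \<partial>lborel) \<le> K"
      unfolding K_def
      by (rule nn_integral_mono) (use x in \<open>auto simp: indicator_def real_powr_minus_three_halves\<close>)
  qed (use fin in \<open>simp add: K_def\<close>)
  finally show "integral {x..y} ?h \<le> enn2real K" .
qed

text \<open>Everything rests on bounding the integral of \<open>- f' s / sqrt s\<close>.
  Monotonicity of that integrand then gives the pointwise bound on
  \<open>sqrt T * \<bar>f' T\<bar>\<close>, the two together bound the integral of the square, and
  one more integration by parts bounds the term with \<open>f''\<close>.\<close>

lemma C2_exponent_bounded:
  assumes C: "C2_halfline f f' f''"
    and fin: "(\<integral>\<^sup>+t\<in>{1..}. ennreal (\<bar>f t\<bar> * t powr (- 3 / 2)) \<partial>lborel) < \<infinity>"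
    and t0: "1 \<le> t0" and sgn: "\<And>t. t0 \<le> t \<Longrightarrow> f' t \<le> 0 \<and> f'' t \<ge> 0"
  obtains K where "\<And>T. 2 * t0 \<le> T \<Longrightarrow>
    integral {0..T} (\<lambda>s. (f' s)\<^sup>2) \<le> K \<and> integral {0..T} (\<lambda>s. \<bar>f'' s\<bar> * sqrt s) \<le> K \<and> sqrt T * \<bar>f' T\<bar> \<le> K"
proof -
  note D = C2_halflineD[OF C]
  have cf: "continuous_on {x..y} f" "continuous_on {x..y} f'" "continuous_on {x..y} f''" if "0 \<le> x" for x y
    using D(1-3) that by (auto intro: continuous_on_subset)
  have der: "(f has_real_derivative f' x) (at x)" "(f' has_real_derivative f'' x) (at x)" if "0 < x" for x
  proof -
    have eq: "at x within {0..} = at x" using that by (intro at_within_interior) simp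
    have "(f has_real_derivative f' x) (at x within {0..})" "(f' has_real_derivative f'' x) (at x within {0..})"
      using C that by (auto simp: C2_halfline_def)
    then show "(f has_real_derivative f' x) (at x)" "(f' has_real_derivative f'' x) (at x)"
      unfolding eq by auto
  qed
  have decr: "f y \<le> f x" if "t0 \<le> x" "x \<le> y" for x y
  proof (rule has_integral_le[of f' "f y - f x" "{x..y}" "\<lambda>_. 0" 0, simplified])
    show "(f' has_integral f y - f x) {x..y}" using D(4) t0 that by auto
  qed (use sgn that in auto)
  have incr': "f' x \<le> f' y" if "t0 \<le> x" "x \<le> y" for x y
  proof -
    have "0 \<le> f' y - f' x"
      by (rule has_integral_nonneg[OF D(5)]) (use sgn t0 that in auto)
    then show ?thesis by simp
  qed
  obtain J where J: "0 \<le> J" "\<And>x y. 1 \<le> x \<Longrightarrow> integral {x..y} (\<lambda>s. \<bar>f s\<bar> / (s * sqrt s)) \<le> J"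
    using weighted_integral_bounded[OF D(1) fin] by blast
  \<comment> \<open>\<open>f\<close> may become negative. As it decreases, its modulus on
    \<open>{T..4 * T}\<close> is then at least \<open>- f T\<close>, and integrating over this
    interval gives the factor \<open>3 / 8\<close>; the constant 8 is generous.\<close>
  have fT: "- f T / sqrt T \<le> 8 * J" if T: "t0 \<le> T" for T
  proof (cases "0 \<le> f T")
    case True
    then have "- f T / sqrt T \<le> 0" using T t0 by simp
    then show ?thesis using J by linarith
  next
    case False
    have T1: "1 \<le> T" using T t0 by simp
    have sq: "sqrt (4 * T) = 2 * sqrt T" by (simp add: real_sqrt_mult)
    have "- f T / (4 * T * sqrt (4 * T)) * (4 * T - T) = integral {T..4 * T} (\<lambda>_. - f T / (4 * T * sqrt (4 * T)))"
      using T1 by simp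
    also have "\<dots> \<le> integral {T..4 * T} (\<lambda>s. \<bar>f s\<bar> / (s * sqrt s))"
    proof (rule integral_le)
      show "(\<lambda>s. \<bar>f s\<bar> / (s * sqrt s)) integrable_on {T..4 * T}"
        using T1 by (intro integrable_continuous_real continuous_intros cf) auto
      fix s assume s: "s \<in> {T..4 * T}"
      have "- f T \<le> \<bar>f s\<bar>" using decr[of T s] T s by auto
      moreover have "s * sqrt s \<le> 4 * T * sqrt (4 * T)" using s T1 by (intro mult_mono) auto
      ultimately show "- f T / (4 * T * sqrt (4 * T)) \<le> \<bar>f s\<bar> / (s * sqrt s)"
        using s T1 False by (intro frac_le) auto
    qed auto
    also have "\<dots> \<le> J" using J(2) T1 by blast
    finally have "- f T / sqrt T * (3 / 8) \<le> J"
      using T1 unfolding sq by (simp add: field_simps)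
    moreover have "v \<le> 8 * J" if "v * (3 / 8) \<le> J" for v
      using that J(1) by linarith
    ultimately show ?thesis by blast
  qed
  \<comment> \<open>Integrating \<open>f s / sqrt s\<close> by parts yields \<open>8 * J\<close>
    from the end point \<open>T\<close>, \<open>J / 2\<close> from the remaining integral and the
    value at \<open>t0\<close>; \<open>9 * J\<close> rounds up.\<close>
  define C1 where "C1 = 9 * J + \<bar>f t0\<bar> / sqrt t0"
  have C1: "0 \<le> C1" using J t0 by (simp add: C1_def)
  have i_g: "(\<lambda>s. - f' s / sqrt s) integrable_on {x..y}" if "0 < x" for x y
    using that by (intro integrable_continuous_real continuous_intros cf) auto
  have G: "integral {t0..T} (\<lambda>s. - f' s / sqrt s) \<le> C1" if T: "t0 \<le> T" for T
  proof -
    have i: "(\<lambda>s. f s / (s * sqrt s)) integrable_on {t0..T}" "(\<lambda>s. \<bar>f s\<bar> / (s * sqrt s)) integrable_on {t0..T}"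
      using t0 by (intro integrable_continuous_real continuous_intros cf; auto)+
    have "((\<lambda>s. f' s / sqrt s - f s / (s * sqrt s) / 2) has_integral f T / sqrt T - f t0 / sqrt t0) {t0..T}"
    proof (rule fundamental_theorem_of_calculus[OF T])
      fix s assume s: "s \<in> {t0..T}"
      then have s0: "0 < s" using t0 by auto
      have "((\<lambda>s. f s / sqrt s) has_real_derivative (f' s * sqrt s - f s * (inverse (sqrt s) / 2)) / (sqrt s * sqrt s)) (at s)"
        using s0 by (intro DERIV_divide der DERIV_real_sqrt) auto
      also have "(f' s * sqrt s - f s * (inverse (sqrt s) / 2)) / (sqrt s * sqrt s) = f' s / sqrt s - f s / (s * sqrt s) / 2"
        using s0 by (simp add: field_simps)
      finally show "((\<lambda>s. f s / sqrt s) has_vector_derivative f' s / sqrt s - f s / (s * sqrt s) / 2) (at s within {t0..T})"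
        by (auto simp: has_real_derivative_iff_has_vector_derivative[symmetric] intro: has_field_derivative_at_within)
    qed
    from has_integral_diff[OF has_integral_neg[OF this] has_integral_divide[OF integrable_integral[OF i(1)]], of 2]
    have "integral {t0..T} (\<lambda>s. - f' s / sqrt s) =
       - (f T / sqrt T - f t0 / sqrt t0) - integral {t0..T} (\<lambda>s. f s / (s * sqrt s)) / 2"
      by (intro integral_unique) simp
    moreover have "- integral {t0..T} (\<lambda>s. f s / (s * sqrt s)) \<le> integral {t0..T} (\<lambda>s. \<bar>f s\<bar> / (s * sqrt s))"
      unfolding Henstock_Kurzweil_Integration.integral_neg[symmetric]
      using t0 i by (intro integral_le) (auto intro!: integrable_neg simp: divide_simps)
    ultimately have "integral {t0..T} (\<lambda>s. - f' s / sqrt s) \<le> - f T / sqrt T + f t0 / sqrt t0 + J / 2"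
      using J(2)[OF t0, of T] by simp
    also have "\<dots> \<le> 8 * J + \<bar>f t0\<bar> / sqrt t0 + J / 2"
      using fT[OF T] t0 by (intro add_mono divide_right_mono) auto
    finally show ?thesis using J by (simp add: C1_def)
  qed
  \<comment> \<open>\<open>- f' s / sqrt s\<close> is decreasing, so its value at \<open>T\<close>
    times the length \<open>T - t0\<close>, at least \<open>T / 2\<close>, is below the
    integral.\<close>
  have sf: "sqrt T * \<bar>f' T\<bar> \<le> 2 * C1" if T: "2 * t0 \<le> T" for T
  proof -
    have T1: "1 \<le> T" "t0 \<le> T" using T t0 by auto
    have "- f' T / sqrt T * (T - t0) = integral {t0..T} (\<lambda>_. - f' T / sqrt T)"
      using T1 by simp
    also have "\<dots> \<le> integral {t0..T} (\<lambda>s. - f' s / sqrt s)"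
    proof (rule integral_le)
      fix s assume s: "s \<in> {t0..T}"
      show "- f' T / sqrt T \<le> - f' s / sqrt s"
        using s t0 sgn[of s] incr'[of s T] by (intro frac_le) auto
    qed (use i_g t0 in auto)
    also have "\<dots> \<le> C1" using G T1 by auto
    finally have *: "- f' T / sqrt T * (T - t0) \<le> C1" .
    have "- f' T / sqrt T * (T / 2) \<le> - f' T / sqrt T * (T - t0)"
      using T T1 sgn[of T] by (intro mult_left_mono divide_nonneg_nonneg) auto
    then have "- f' T / sqrt T * (T / 2) \<le> C1" using * by simp
    moreover have "- f' T / sqrt T * (T / 2) = sqrt T * \<bar>f' T\<bar> / 2"
      using T1 sgn[of T] by (simp add: field_simps)
    ultimately have "sqrt T * \<bar>f' T\<bar> / 2 \<le> C1" by (simp only:)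
    then show ?thesis by linarith
  qed
  \<comment> \<open>From \<open>t1\<close> on, the pointwise bound \<open>sf\<close> is available;
    the part before \<open>t1\<close> contributes only a constant.\<close>
  define t1 where "t1 = 2 * t0"
  have t1: "0 < t1" "t0 \<le> t1" using t0 by (auto simp: t1_def)
  have G1: "integral {t1..T} (\<lambda>s. - f' s / sqrt s) \<le> C1" if T: "t1 \<le> T" for T
  proof -
    have "integral {t1..T} (\<lambda>s. - f' s / sqrt s) \<le> integral {t0..T} (\<lambda>s. - f' s / sqrt s)"
      using t0 t1 T sgn by (intro integral_subset_le i_g) (auto simp: divide_simps)
    then show ?thesis using G[of T] t1 T by simp
  qed
  have i1: "(\<lambda>s. (f' s)\<^sup>2) integrable_on {x..y}" if "0 \<le> x" for x y
    by (intro integrable_continuous_real continuous_intros cf that)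
  have i2: "(\<lambda>s. \<bar>f'' s\<bar> * sqrt s) integrable_on {x..y}" if "0 \<le> x" for x y
    by (intro integrable_continuous_real continuous_intros cf that)
  \<comment> \<open>One factor \<open>\<bar>f' s\<bar>\<close> is bounded by
    \<open>2 * C1 / sqrt s\<close> through \<open>sf\<close>; the other is integrated against
    \<open>1 / sqrt s\<close>.\<close>
  have E1: "integral {t1..T} (\<lambda>s. (f' s)\<^sup>2) \<le> 2 * C1 * C1" if T: "t1 \<le> T" for T
  proof -
    have "integral {t1..T} (\<lambda>s. (f' s)\<^sup>2) \<le> integral {t1..T} (\<lambda>s. 2 * C1 * (- f' s / sqrt s))"
    proof (rule integral_le)
      fix s assume s: "s \<in> {t1..T}"
      have "sqrt s * \<bar>f' s\<bar> \<le> 2 * C1" using sf[of s] s by (simp add: t1_def)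
      then have "sqrt s * \<bar>f' s\<bar> * (\<bar>f' s\<bar> / sqrt s) \<le> 2 * C1 * (\<bar>f' s\<bar> / sqrt s)"
        using s t1 by (intro mult_right_mono) auto
      then show "(f' s)\<^sup>2 \<le> 2 * C1 * (- f' s / sqrt s)"
        using s t1 sgn[of s] by (simp add: power2_eq_square)
    qed (intro i1 integrable_on_mult_right i_g t1(1) less_imp_le[OF t1(1)])+
    also have "\<dots> = 2 * C1 * integral {t1..T} (\<lambda>s. - f' s / sqrt s)"
      by (rule integral_mult_right)
    also have "\<dots> \<le> 2 * C1 * C1" using G1[OF T] C1 by (intro mult_left_mono) auto
    finally show ?thesis .
  qed
  \<comment> \<open>Integration by parts of \<open>f' s * sqrt s\<close>: the end point
    \<open>T\<close> has the favourable sign, the end point \<open>t1\<close> costs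
    \<open>2 * C1\<close>, and the remaining integral costs \<open>C1 / 2\<close>.\<close>
  have E2: "integral {t1..T} (\<lambda>s. \<bar>f'' s\<bar> * sqrt s) \<le> 3 * C1" if T: "t1 \<le> T" for T
  proof -
    have "((\<lambda>s. f'' s * sqrt s + f' s / sqrt s / 2) has_integral f' T * sqrt T - f' t1 * sqrt t1) {t1..T}"
    proof (rule fundamental_theorem_of_calculus[OF T])
      fix s assume s: "s \<in> {t1..T}"
      then have s0: "0 < s" using t1 by auto
      have "((\<lambda>s. f' s * sqrt s) has_real_derivative f'' s * sqrt s + inverse (sqrt s) / 2 * f' s) (at s)"
        using s0 by (intro DERIV_mult der DERIV_real_sqrt) auto
      then have "((\<lambda>s. f' s * sqrt s) has_real_derivative f'' s * sqrt s + f' s / sqrt s / 2) (at s)"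
        by (simp add: field_simps)
      then show "((\<lambda>s. f' s * sqrt s) has_vector_derivative f'' s * sqrt s + f' s / sqrt s / 2) (at s within {t1..T})"
        by (auto simp: has_real_derivative_iff_has_vector_derivative[symmetric] intro: has_field_derivative_at_within)
    qed
    from has_integral_add[OF this has_integral_divide[OF integrable_integral[OF i_g[OF t1(1)]]], of 2]
    have "integral {t1..T} (\<lambda>s. f'' s * sqrt s) =
       (f' T * sqrt T - f' t1 * sqrt t1) + integral {t1..T} (\<lambda>s. - f' s / sqrt s) / 2"
      by (intro integral_unique) simp
    also have "\<dots> \<le> 0 + 2 * C1 + C1 / 2"
    proof -
      have "f' T * sqrt T \<le> 0" using sgn[of T] t1 T by (intro mult_nonpos_nonneg) auto
      moreover have "- f' t1 * sqrt t1 \<le> 2 * C1" using sf[of t1] sgn[of t1] t1 by (simp add: t1_def mult.commute)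
      ultimately show ?thesis using G1[OF T] by linarith
    qed
    finally have "integral {t1..T} (\<lambda>s. f'' s * sqrt s) \<le> 3 * C1" using C1 by linarith
    moreover have "integral {t1..T} (\<lambda>s. \<bar>f'' s\<bar> * sqrt s) = integral {t1..T} (\<lambda>s. f'' s * sqrt s)"
      using sgn t1 by (intro Henstock_Kurzweil_Integration.integral_cong) auto
    ultimately show ?thesis by simp
  qed
  define K where "K = Max {integral {0..t1} (\<lambda>s. (f' s)\<^sup>2) + 2 * C1 * C1,
     integral {0..t1} (\<lambda>s. \<bar>f'' s\<bar> * sqrt s) + 3 * C1, 2 * C1}"
  show ?thesis
  proof (rule that[of K])
    fix T assume T: "2 * t0 \<le> T"
    then have T1: "t1 \<le> T" by (simp add: t1_def)
    have "integral {0..T} (\<lambda>s. (f' s)\<^sup>2) = integral {0..t1} (\<lambda>s. (f' s)\<^sup>2) + integral {t1..T} (\<lambda>s. (f' s)\<^sup>2)"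
      using t1 T1 by (intro Henstock_Kurzweil_Integration.integral_combine[symmetric] i1) auto
    also have "\<dots> \<le> integral {0..t1} (\<lambda>s. (f' s)\<^sup>2) + 2 * C1 * C1" using E1[OF T1] by simp
    also have "\<dots> \<le> K" unfolding K_def by (rule Max_ge) auto
    finally have 1: "integral {0..T} (\<lambda>s. (f' s)\<^sup>2) \<le> K" .
    have "integral {0..T} (\<lambda>s. \<bar>f'' s\<bar> * sqrt s) = integral {0..t1} (\<lambda>s. \<bar>f'' s\<bar> * sqrt s) + integral {t1..T} (\<lambda>s. \<bar>f'' s\<bar> * sqrt s)"
      using t1 T1 by (intro Henstock_Kurzweil_Integration.integral_combine[symmetric] i2) auto
    also have "\<dots> \<le> integral {0..t1} (\<lambda>s. \<bar>f'' s\<bar> * sqrt s) + 3 * C1" using E2[OF T1] by simp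
    also have "\<dots> \<le> K" unfolding K_def by (rule Max_ge) auto
    finally have 2: "integral {0..T} (\<lambda>s. \<bar>f'' s\<bar> * sqrt s) \<le> K" .
    have "sqrt T * \<bar>f' T\<bar> \<le> 2 * C1" by (rule sf[OF T])
    also have "\<dots> \<le> K" unfolding K_def by (rule Max_ge) auto
    finally show "integral {0..T} (\<lambda>s. (f' s)\<^sup>2) \<le> K \<and> integral {0..T} (\<lambda>s. \<bar>f'' s\<bar> * sqrt s) \<le> K \<and> sqrt T * \<bar>f' T\<bar> \<le> K"
      using 1 2 by simp
  qed
qed

section \<open>Two-sided bound of inverse square-root order\<close>

context standard_brownian_motion begin

text \<open>Above, an eventually decreasing boundary stays below a constant level, whose survival
  probability is explicit. Below, the exponential factor is bounded away from \<open>0\<close> by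
  \<open>C2_exponent_bounded\<close>.\<close>

lemma moving_boundary_asymptotics:
  assumes C: "C2_halfline f f' f''" and f0: "f 0 > 0"
    and fin: "(\<integral>\<^sup>+t\<in>{1..}. ennreal (\<bar>f t\<bar> * t powr (- 3 / 2)) \<partial>lborel) < \<infinity>"
    and sgn: "\<forall>\<^sub>F t in at_top. f' t \<le> 0 \<and> f'' t \<ge> 0"
  obtains \<alpha> \<beta> :: real where "0 < \<alpha>" "0 < \<beta>"
    "\<forall>\<^sub>F T in at_top. \<beta> * T powr (- 1 / 2) \<le> prob {\<omega> \<in> space M. \<forall>t\<in>{0..T}. B t \<omega> \<le> f t} \<and>
       prob {\<omega> \<in> space M. \<forall>t\<in>{0..T}. B t \<omega> \<le> f t} \<le> \<alpha> * T powr (- 1 / 2)"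
proof -
  note D = C2_halflineD[OF C]
  obtain t0' where t0': "\<And>t. t0' \<le> t \<Longrightarrow> f' t \<le> 0 \<and> f'' t \<ge> 0"
    using sgn by (auto simp: eventually_at_top_linorder)
  define t0 where "t0 = max 1 t0'"
  have t0: "1 \<le> t0" "\<And>t. t0 \<le> t \<Longrightarrow> f' t \<le> 0 \<and> f'' t \<ge> 0" using t0' by (auto simp: t0_def)
  have "\<exists>x\<in>{0..t0}. \<forall>y\<in>{0..t0}. f y \<le> f x"
    using t0(1) D(1) by (intro continuous_attains_sup continuous_on_subset[OF D(1)]) auto
  then obtain x where x: "x \<in> {0..t0}" "\<And>y. y \<in> {0..t0} \<Longrightarrow> f y \<le> f x" by blast
  define c where "c = f x"
  have c0: "0 < c" using x(2)[of 0] f0 t0 by (simp add: c_def)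
  have fc: "f t \<le> c" if "0 \<le> t" for t
  proof (cases "t \<le> t0")
    case False
    have "f t - f t0 \<le> 0"
      using has_integral_le[OF D(4)[of t0 t] has_integral_0[of "{t0..t}"]] t0 False by auto
    then show ?thesis using x(2)[of t0] t0 by (simp add: c_def)
  qed (use x(2) that in \<open>auto simp: c_def\<close>)
  obtain K where K: "\<And>T. 2 * t0 \<le> T \<Longrightarrow>
    integral {0..T} (\<lambda>s. (f' s)\<^sup>2) \<le> K \<and> integral {0..T} (\<lambda>s. \<bar>f'' s\<bar> * sqrt s) \<le> K \<and> sqrt T * \<bar>f' T\<bar> \<le> K"
    using C2_exponent_bounded[OF C fin t0] by blast
  define \<alpha> where "\<alpha> = 2 * c / sqrt (2 * pi)"
  \<comment> \<open>The exponent is at least \<open>- (1/2 + 6 + 6) * K\<close>, rounded to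
    \<open>- 13 * K\<close> since \<open>K\<close> is nonnegative; the Gaussian factor is its value
    at \<open>T = 1\<close>, the smallest for \<open>T \<ge> 1\<close>.\<close>
  define \<beta> where "\<beta> = 2 * f 0 / sqrt (2 * pi) * exp (- (f 0)\<^sup>2 / 2) * exp (- 13 * K)"
  let ?P = "\<lambda>T. prob {\<omega> \<in> space M. \<forall>t\<in>{0..T}. B t \<omega> \<le> f t}"
  show ?thesis
  proof (rule that[of \<alpha> \<beta>])
    show "0 < \<alpha>" "0 < \<beta>" using c0 f0 by (auto simp: \<alpha>_def \<beta>_def)
    show "\<forall>\<^sub>F T in at_top. \<beta> * T powr (- 1 / 2) \<le> ?P T \<and> ?P T \<le> \<alpha> * T powr (- 1 / 2)"
      using eventually_ge_at_top[of "2 * t0"]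
    proof eventually_elim
      case (elim T)
      have T: "1 \<le> T" "0 < T" using elim t0 by auto
      have pow: "T powr (- 1 / 2) = 1 / sqrt T"
        using T by (simp add: powr_minus_divide powr_half_sqrt)
      have cf: "continuous_on {0..T} f'" "continuous_on {0..T} f''"
        using D(2,3) by (auto intro: continuous_on_subset)
      have "?P T \<le> prob (stay T c)"
        using T fc by (intro finite_measure_mono stay_events) (auto simp: stay_def intro: order_trans)
      also have "\<dots> \<le> 2 * c / sqrt (2 * pi * T)" using T c0 by (intro prob_stay_bounds) auto
      also have "\<dots> = \<alpha> * T powr (- 1 / 2)" unfolding pow by (simp add: \<alpha>_def real_sqrt_mult)
      finally have up: "?P T \<le> \<alpha> * T powr (- 1 / 2)" .
      have L: "(LBINT s:{0..T}. (f' s)\<^sup>2) = integral {0..T} (\<lambda>s. (f' s)\<^sup>2)"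
        "(LBINT s:{0..T}. \<bar>f'' s\<bar> * sqrt s) = integral {0..T} (\<lambda>s. \<bar>f'' s\<bar> * sqrt s)"
        using cf by (intro LBINT_Icc_eq_integral continuous_intros; simp)+
      have KT: "integral {0..T} (\<lambda>s. (f' s)\<^sup>2) \<le> K" "integral {0..T} (\<lambda>s. \<bar>f'' s\<bar> * sqrt s) \<le> K" "sqrt T * \<bar>f' T\<bar> \<le> K"
        using K[OF elim] by auto
      have "0 \<le> sqrt T * \<bar>f' T\<bar>" using T by simp
      then have K0: "0 \<le> K" using KT(3) by linarith
      have "(f 0)\<^sup>2 / (2 * T) \<le> (f 0)\<^sup>2 / 2"
        using T by (intro divide_left_mono) auto
      then have "2 * f 0 / sqrt (2 * pi * T) * exp (- (f 0)\<^sup>2 / 2) \<le> 2 * f 0 / sqrt (2 * pi * T) * exp (- (f 0)\<^sup>2 / (2 * T))"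
        using T f0 by (intro mult_left_mono) auto
      also have "\<dots> \<le> prob (stay T (f 0))" using T f0 by (intro prob_stay_bounds) auto
      finally have st: "2 * f 0 / sqrt (2 * pi * T) * exp (- (f 0)\<^sup>2 / 2) \<le> prob (stay T (f 0))" .
      have "\<beta> * T powr (- 1 / 2) = 2 * f 0 / sqrt (2 * pi * T) * exp (- (f 0)\<^sup>2 / 2) * exp (- 13 * K)"
        unfolding pow by (simp add: \<beta>_def real_sqrt_mult)
      also have "\<dots> \<le> prob (stay T (f 0)) * exp (- (1 / 2) * (LBINT s:{0..T}. (f' s)\<^sup>2)
      - 6 * (LBINT s:{0..T}. \<bar>f'' s\<bar> * sqrt s) - 6 * sqrt T * \<bar>f' T\<bar>)"
      proof (intro mult_mono st)
        have "6 * sqrt T * \<bar>f' T\<bar> = 6 * (sqrt T * \<bar>f' T\<bar>)" by simp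
        then show "exp (- 13 * K) \<le> exp (- (1 / 2) * (LBINT s:{0..T}. (f' s)\<^sup>2)
          - 6 * (LBINT s:{0..T}. \<bar>f'' s\<bar> * sqrt s) - 6 * sqrt T * \<bar>f' T\<bar>)"
          unfolding L exp_le_cancel_iff using KT K0 by linarith
      qed auto
      also have "\<dots> \<le> ?P T" by (rule moving_boundary_lower_bound[OF C f0 T(2)])
      finally show ?case using up by simp
    qed
  qed
qed

end

theorem theorem2:
  fixes M :: "'a measure" and B :: "real \<Rightarrow> 'a \<Rightarrow> real"
  assumes "standard_brownian_motion M B"
  shows
    "(\<exists>c\<^sub>1 c\<^sub>2 :: real. 0 < c\<^sub>1 \<and> 0 < c\<^sub>2 \<and>
       (\<forall>f f' f'' :: real \<Rightarrow> real. \<forall>T :: real.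
          C2_halfline f f' f'' \<longrightarrow> f 0 > 0 \<longrightarrow> T > 0 \<longrightarrow>
          measure M {\<omega> \<in> space M. \<forall>t\<in>{0..T}. B t \<omega> \<le> f t}
            \<ge> measure M {\<omega> \<in> space M. \<forall>t\<in>{0..T}. B t \<omega> \<le> f 0} *
              exp (- (1 / 2) * (LBINT s:{0..T}. (f' s)\<^sup>2)
                   - c\<^sub>1 * (LBINT s:{0..T}. \<bar>f'' s\<bar> * sqrt s)
                   - c\<^sub>2 * sqrt T * \<bar>f' T\<bar>)))
     \<and>
     (\<forall>f f' f'' :: real \<Rightarrow> real.
        C2_halfline f f' f'' \<longrightarrow> f 0 > 0 \<longrightarrow>
        (\<integral>\<^sup>+t\<in>{1..}. ennreal (\<bar>f t\<bar> * t powr (- 3 / 2)) \<partial>lborel) < \<infinity> \<longrightarrow>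
        (\<forall>\<^sub>F t in at_top. f' t \<le> 0 \<and> f'' t \<ge> 0) \<longrightarrow>
        (\<exists>k\<^sub>1 k\<^sub>2 :: real. 0 < k\<^sub>1 \<and> k\<^sub>1 \<le> k\<^sub>2 \<and>
          (\<forall>\<^sub>F T in at_top.
             k\<^sub>1 * measure M {\<omega> \<in> space M. \<forall>t\<in>{0..T}. B t \<omega> \<le> f t} \<le> T powr (- 1 / 2) \<and>
             T powr (- 1 / 2) \<le> k\<^sub>2 * measure M {\<omega> \<in> space M. \<forall>t\<in>{0..T}. B t \<omega> \<le> f t})))"
proof -
  interpret standard_brownian_motion M B by fact
  show ?thesis
  proof (intro conjI)
    show "\<exists>c\<^sub>1 c\<^sub>2 :: real. 0 < c\<^sub>1 \<and> 0 < c\<^sub>2 \<and>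
       (\<forall>f f' f'' :: real \<Rightarrow> real. \<forall>T :: real.
          C2_halfline f f' f'' \<longrightarrow> f 0 > 0 \<longrightarrow> T > 0 \<longrightarrow>
          prob {\<omega> \<in> space M. \<forall>t\<in>{0..T}. B t \<omega> \<le> f t}
            \<ge> prob {\<omega> \<in> space M. \<forall>t\<in>{0..T}. B t \<omega> \<le> f 0} *
              exp (- (1 / 2) * (LBINT s:{0..T}. (f' s)\<^sup>2)
                   - c\<^sub>1 * (LBINT s:{0..T}. \<bar>f'' s\<bar> * sqrt s)
                   - c\<^sub>2 * sqrt T * \<bar>f' T\<bar>))"
      using moving_boundary_lower_bound unfolding stay_def
      by (intro exI[of _ 6]) auto
  next
    show "\<forall>f f' f'' :: real \<Rightarrow> real.
        C2_halfline f f' f'' \<longrightarrow> f 0 > 0 \<longrightarrow>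
        (\<integral>\<^sup>+t\<in>{1..}. ennreal (\<bar>f t\<bar> * t powr (- 3 / 2)) \<partial>lborel) < \<infinity> \<longrightarrow>
        (\<forall>\<^sub>F t in at_top. f' t \<le> 0 \<and> f'' t \<ge> 0) \<longrightarrow>
        (\<exists>k\<^sub>1 k\<^sub>2 :: real. 0 < k\<^sub>1 \<and> k\<^sub>1 \<le> k\<^sub>2 \<and>
          (\<forall>\<^sub>F T in at_top.
             k\<^sub>1 * prob {\<omega> \<in> space M. \<forall>t\<in>{0..T}. B t \<omega> \<le> f t} \<le> T powr (- 1 / 2) \<and>
             T powr (- 1 / 2) \<le> k\<^sub>2 * prob {\<omega> \<in> space M. \<forall>t\<in>{0..T}. B t \<omega> \<le> f t}))"
    proof (intro allI impI)
      fix f f' f'' :: "real \<Rightarrow> real"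
      assume "C2_halfline f f' f''" "f 0 > 0"
        "(\<integral>\<^sup>+t\<in>{1..}. ennreal (\<bar>f t\<bar> * t powr (- 3 / 2)) \<partial>lborel) < \<infinity>"
        "\<forall>\<^sub>F t in at_top. f' t \<le> 0 \<and> f'' t \<ge> 0"
      then obtain \<alpha> \<beta> :: real where ab: "0 < \<alpha>" "0 < \<beta>"
        and ev: "\<forall>\<^sub>F T in at_top. \<beta> * T powr (- 1 / 2) \<le> prob {\<omega> \<in> space M. \<forall>t\<in>{0..T}. B t \<omega> \<le> f t} \<and>
          prob {\<omega> \<in> space M. \<forall>t\<in>{0..T}. B t \<omega> \<le> f t} \<le> \<alpha> * T powr (- 1 / 2)"
        by (rule moving_boundary_asymptotics)
      show "\<exists>k\<^sub>1 k\<^sub>2 :: real. 0 < k\<^sub>1 \<and> k\<^sub>1 \<le> k\<^sub>2 \<and>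
          (\<forall>\<^sub>F T in at_top.
             k\<^sub>1 * prob {\<omega> \<in> space M. \<forall>t\<in>{0..T}. B t \<omega> \<le> f t} \<le> T powr (- 1 / 2) \<and>
             T powr (- 1 / 2) \<le> k\<^sub>2 * prob {\<omega> \<in> space M. \<forall>t\<in>{0..T}. B t \<omega> \<le> f t})"
      proof (intro exI conjI)
        \<comment> \<open>The maximum secures the required order of the two constants without
          comparing \<open>\<alpha>\<close> and \<open>\<beta>\<close>.\<close>
        show "0 < 1 / \<alpha>" "1 / \<alpha> \<le> max (1 / \<alpha>) (1 / \<beta>)" using ab by auto
        show "\<forall>\<^sub>F T in at_top.
             1 / \<alpha> * prob {\<omega> \<in> space M. \<forall>t\<in>{0..T}. B t \<omega> \<le> f t} \<le> T powr (- 1 / 2) \<and>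
             T powr (- 1 / 2) \<le> max (1 / \<alpha>) (1 / \<beta>) * prob {\<omega> \<in> space M. \<forall>t\<in>{0..T}. B t \<omega> \<le> f t}"
          using ev
        proof eventually_elim
          case (elim T)
          let ?P = "prob {\<omega> \<in> space M. \<forall>t\<in>{0..T}. B t \<omega> \<le> f t}"
          have "1 / \<alpha> * ?P \<le> T powr (- 1 / 2)"
            using elim ab by (simp add: pos_divide_le_eq mult.commute)
          moreover have "T powr (- 1 / 2) \<le> 1 / \<beta> * ?P"
            using elim ab by (simp add: pos_le_divide_eq mult.commute)
          moreover have "1 / \<beta> * ?P \<le> max (1 / \<alpha>) (1 / \<beta>) * ?P"
            by (intro mult_right_mono) auto
          ultimately show ?case by linarith
        qed
      qed
    qed
  qed
qed

end
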